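(* Assume that $P(x,y)>0$ for all $x,y\in X$ and that there is a constant $C_*\ge 1$ with $P_2(x,y)\le C_*P(x,y)$ for all $x,y\in X$; that $\sup_{x,y\in X}P(x,y)/\mu(y)<\infty$; and that the potential $V$ is confining. The following three conditions are equivalent: (a) The semigroup $\{\mathcal U_n:n\in\mathbb N_0\}$ is aIUC. (b) The semigroup $\{\mathcal Q_n:n\in\mathbb N_0\}$ is geometrically uniformly ergodic on $\ell^1(\nu)$, that is, there exist $C_1>0$ and $\rho\in(0,1)$ such that for all sufficiently large $n$ and all $f\in\ell^1(\nu)$ $$\sup_{x\in X}\big|\mathcal Q_nf(x)-\bar\nu(f)\big|\le C_1\rho^n\|f\|_{\ell^1(\nu)}.$$ (c) The semigroup $\{\mathcal U_n:n\in\mathbb N_0\}$ is geometrically uniformly quasi-ergodic on $\ell^1(m)$, that is, there exist $C_2>0$ and $\rho\in(0,1)$ such that for all sufficiently large $n$ and all $f\in\ell^1(m)$ $$\sup_{x\in X}\left|\frac{\mathcal U_nf(x)}{\mathcal U_n\mathbf 1(x)}-m(f)\right|\le C_2\rho^n\|f\|_{\ell^1(m)}.$$ These equivalences remain true if one replaces $\mathcal Q_n,\mathcal U_n,m$ with $\widehat{\mathcal Q}_n,\widehat{\mathcal U}_n,\widehat m$. Moreover, any of the conditions (a), (b), (c) is equivalent to the corresponding statements for the dual semigroups $\{\widehat{\mathcal U}_n:n\in\mathbb N_0\}$ and $\{\widehat{\mathcal Q}_n:n\in\mathbb N_0\}$ and $\widehat m$.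
   Context: $X$ is a countably infinite set, $\mathbb N=\{1,2,\dots\}$, $\mathbb N_0=\mathbb N\cup\{0\}$, $\mathbf 1$ is the constant function $1$. $P:X\times X\to[0,1]$ is a (sub-)probability kernel, i.e. $\sum_{y\in X}P(x,y)\le1$ for all $x$. It is assumed throughout that there are a (sub-)probability kernel $\widehat P:X\times X\to[0,1]$ and a measure $\mu:X\to(0,\infty)$ with $\mu(x)P(x,y)=\mu(y)\widehat P(y,x)$ for all $x,y\in X$. Put $P_2(x,y)=\sum_{z\in X}P(x,z)P(z,y)$. A potential is a function $V:X\to(0,\infty)$ with $\inf_{x\in X}V(x)>0$ (standing assumption). It is confining if for every $M\in\mathbb N$ there is a finite set $B_M\subset X$ with $V(x)\ge M$ for all $x\in X\setminus B_M$. Let $\mathcal U f(x)=\frac1{V(x)}\sum_{y}P(x,y)f(y)$ and $\widehat{\mathcal U}f(x)=\sum_y\widehat P(x,y)\frac1{V(y)}f(y)$; these are mutually adjoint on $\ell^2(\mu)$. Let $\mathcal U_n=\mathcal U^n$, $\widehat{\mathcal U}_n=\widehat{\mathcal U}^n$. Under the hypotheses of the claim, $\mathcal U,\widehat{\mathcal U}$ are compact on $\ell^2(\mu)$ and $\lambda_0:=\sup_{\lambda\in\sigma(\mathcal U)}|\lambda|=\sup_{\lambda\in\sigma(\widehat{\mathcal U})}|\lambda|>0$ is a simple eigenvalue of both; $\varphi_0,\widehat\varphi_0$ denote the corresponding strictly positive eigenfunctions, $\mathcal U\varphi_0=\lambda_0\varphi_0$, $\widehat{\mathcal U}\widehat\varphi_0=\lambda_0\widehat\varphi_0$,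 normalized by $\|\varphi_0\|_{\ell^2(\mu)}=\|\widehat\varphi_0\|_{\ell^2(\mu)}=1$. Moreover $\varphi_0,\widehat\varphi_0\in\ell^1(\mu)\cap\ell^\infty(\mu)$. Let $\nu(x)=\varphi_0(x)\widehat\varphi_0(x)\mu(x)$, a finite measure with total mass $\|\nu\|=\sum_x\nu(x)$, and $\bar\nu(f)=\frac1{\|\nu\|}\sum_yf(y)\nu(y)$. The intrinsic semigroups are $\mathcal Q_nf=\lambda_0^{-n}\varphi_0^{-1}\,\mathcal U_n(f\varphi_0)$ and $\widehat{\mathcal Q}_nf=\lambda_0^{-n}\widehat\varphi_0^{-1}\,\widehat{\mathcal U}_n(f\widehat\varphi_0)$. The probability measures $m,\widehat m$ are $m(x)=\widehat\varphi_0(x)\mu(x)/\|\widehat\varphi_0\|_{\ell^1(\mu)}$ and $\widehat m(x)=\varphi_0(x)\mu(x)/\|\varphi_0\|_{\ell^1(\mu)}$, with $m(f)=\sum_xf(x)m(x)$ and similarly for $\widehat m$. $\{\mathcal U_n\}$ (resp. $\{\widehat{\mathcal U}_n\}$) is aIUC (asymptotically intrinsically ultracontractive) if there is $n_0\in\mathbb N$ such that $\mathcal Q_{n_0}$ (resp. $\widehat{\mathcal Q}_{n_0}$) is bounded from $\ell^1(\nu)$ to $\ell^\infty(\nu)$. *)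

theory Defs
  imports "HOL-Analysis.Analysis"
begin

definition subprob_kernel :: "('a \<Rightarrow> 'a \<Rightarrow> real) \<Rightarrow> bool" where
  "subprob_kernel P \<longleftrightarrow>
     (\<forall>x y. 0 \<le> P x y \<and> P x y \<le> 1) \<and>
     (\<forall>x. P x summable_on UNIV \<and> (\<Sum>\<^sub>\<infinity>y. P x y) \<le> 1)"

definition two_step :: "('a \<Rightarrow> 'a \<Rightarrow> real) \<Rightarrow> 'a \<Rightarrow> 'a \<Rightarrow> real" where
  "two_step P x y = (\<Sum>\<^sub>\<infinity>z. P x z * P z y)"

definition potential :: "('a \<Rightarrow> real) \<Rightarrow> bool" where
  "potential V \<longleftrightarrow> (\<forall>x. 0 < V x) \<and> 0 < (INF x. V x)"

definition confining :: "('a \<Rightarrow> real) \<Rightarrow> bool" where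
  "confining V \<longleftrightarrow> (\<forall>M::nat. 1 \<le> M \<longrightarrow> (\<exists>B. finite B \<and> (\<forall>x. x \<notin> B \<longrightarrow> real M \<le> V x)))"

text \<open>
  Weighted sequence spaces. A measure on the discrete space is given by its point masses
  \<open>w\<close>; functions may be real- or complex-valued. All weights used below are strictly positive,
  so no identification of functions almost everywhere is needed.
\<close>

definition l1 :: "('a \<Rightarrow> real) \<Rightarrow> ('a \<Rightarrow> 'b::real_normed_vector) set" where
  "l1 w = {f. (\<lambda>x. norm (f x) * w x) summable_on UNIV}"

definition l1_norm :: "('a \<Rightarrow> real) \<Rightarrow> ('a \<Rightarrow> 'b::real_normed_vector) \<Rightarrow> real" where
  "l1_norm w f = (\<Sum>\<^sub>\<infinity>x. norm (f x) * w x)"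

definition l2 :: "('a \<Rightarrow> real) \<Rightarrow> ('a \<Rightarrow> 'b::real_normed_vector) set" where
  "l2 w = {f. (\<lambda>x. (norm (f x))\<^sup>2 * w x) summable_on UNIV}"

definition l2_norm :: "('a \<Rightarrow> real) \<Rightarrow> ('a \<Rightarrow> 'b::real_normed_vector) \<Rightarrow> real" where
  "l2_norm w f = sqrt (\<Sum>\<^sub>\<infinity>x. (norm (f x))\<^sup>2 * w x)"

definition bounded_l1_linf :: "('a \<Rightarrow> real) \<Rightarrow> (('a \<Rightarrow> real) \<Rightarrow> 'a \<Rightarrow> real) \<Rightarrow> bool" where
  "bounded_l1_linf w T \<longleftrightarrow>
     (\<exists>C. \<forall>f\<in>l1 w. \<forall>x. w x \<noteq> 0 \<longrightarrow> \<bar>T f x\<bar> \<le> C * l1_norm w f)"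

text \<open>
  The spectrum is that of an operator on the complex space \<open>\<ell>\<^sup>2(w)\<close>: a number \<open>z\<close> lies in the
  resolvent set iff \<open>z - T\<close> is a bijection of \<open>\<ell>\<^sup>2(w)\<close> with bounded inverse.
\<close>

definition l2_spectrum ::
    "('a \<Rightarrow> real) \<Rightarrow> (('a \<Rightarrow> complex) \<Rightarrow> 'a \<Rightarrow> complex) \<Rightarrow> complex set" where
  "l2_spectrum w T = {z. \<not> (bij_betw (\<lambda>f x. z * f x - T f x) (l2 w) (l2 w) \<and>
     (\<exists>C. \<forall>f\<in>l2 w. l2_norm w f \<le> C * l2_norm w (\<lambda>x. z * f x - T f x)))}"

definition l2_spectral_radius ::
    "('a \<Rightarrow> real) \<Rightarrow> (('a \<Rightarrow> complex) \<Rightarrow> 'a \<Rightarrow> complex) \<Rightarrow> real" where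
  "l2_spectral_radius w T = (SUP z\<in>l2_spectrum w T. cmod z)"

text \<open>
  The one-step operators of the Feynman--Kac semigroup and its dual. They are polymorphic in the
  scalars: the complex instance is used for the spectrum, the real one everywhere else.
  The semigroups are the iterates \<open>opU P V ^^ n\<close> and \<open>opUhat Ph V ^^ n\<close>.
\<close>

definition opU :: "('a \<Rightarrow> 'a \<Rightarrow> real) \<Rightarrow> ('a \<Rightarrow> real) \<Rightarrow> ('a \<Rightarrow> 'b::real_normed_vector) \<Rightarrow> 'a \<Rightarrow> 'b" where
  "opU P V f x = (1 / V x) *\<^sub>R (\<Sum>\<^sub>\<infinity>y. P x y *\<^sub>R f y)"

definition opUhat :: "('a \<Rightarrow> 'a \<Rightarrow> real) \<Rightarrow> ('a \<Rightarrow> real) \<Rightarrow> ('a \<Rightarrow> 'b::real_normed_vector) \<Rightarrow> 'a \<Rightarrow> 'b" where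
  "opUhat Ph V f x = (\<Sum>\<^sub>\<infinity>y. (Ph x y * (1 / V y)) *\<^sub>R f y)"

definition positive_normalized_eigenfunction ::
    "('a \<Rightarrow> real) \<Rightarrow> (('a \<Rightarrow> real) \<Rightarrow> 'a \<Rightarrow> real) \<Rightarrow> real \<Rightarrow> ('a \<Rightarrow> real) \<Rightarrow> bool" where
  "positive_normalized_eigenfunction \<mu> T lam \<phi> \<longleftrightarrow>
     (\<forall>x. 0 < \<phi> x) \<and> \<phi> \<in> l2 \<mu> \<and> l2_norm \<mu> \<phi> = 1 \<and> (\<forall>x. T \<phi> x = lam * \<phi> x)"

definition nu :: "('a \<Rightarrow> real) \<Rightarrow> ('a \<Rightarrow> real) \<Rightarrow> ('a \<Rightarrow> real) \<Rightarrow> 'a \<Rightarrow> real" where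
  "nu \<mu> \<phi> \<phi>h x = \<phi> x * \<phi>h x * \<mu> x"

definition mean :: "('a \<Rightarrow> real) \<Rightarrow> ('a \<Rightarrow> real) \<Rightarrow> real" where
  "mean w f = (1 / (\<Sum>\<^sub>\<infinity>y. w y)) * (\<Sum>\<^sub>\<infinity>y. f y * w y)"

text \<open>
  The probability measure with density \<open>\<psi> / \<parallel>\<psi>\<parallel>\<close> (norm in \<open>\<ell>\<^sup>1(\<mu>)\<close>) with respect to \<open>\<mu>\<close>.
  The measure attached to the original semigroup uses the dual eigenfunction, and vice versa.
\<close>

definition quasi_stat :: "('a \<Rightarrow> real) \<Rightarrow> ('a \<Rightarrow> real) \<Rightarrow> 'a \<Rightarrow> real" where
  "quasi_stat \<mu> \<psi> x = \<psi> x * \<mu> x / l1_norm \<mu> \<psi>"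

definition intrinsic ::
    "(('a \<Rightarrow> real) \<Rightarrow> 'a \<Rightarrow> real) \<Rightarrow> real \<Rightarrow> ('a \<Rightarrow> real) \<Rightarrow> nat \<Rightarrow> ('a \<Rightarrow> real) \<Rightarrow> 'a \<Rightarrow> real" where
  "intrinsic T lam \<phi> n f x = (1 / lam ^ n) * (1 / \<phi> x) * (T ^^ n) (\<lambda>y. f y * \<phi> y) x"

definition aIUC ::
    "(('a \<Rightarrow> real) \<Rightarrow> 'a \<Rightarrow> real) \<Rightarrow> real \<Rightarrow> ('a \<Rightarrow> real) \<Rightarrow> ('a \<Rightarrow> real) \<Rightarrow> bool" where
  "aIUC T lam \<phi> \<nu> \<longleftrightarrow> (\<exists>n0::nat. 1 \<le> n0 \<and> bounded_l1_linf \<nu> (intrinsic T lam \<phi> n0))"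

text \<open>
  In the next two definitions \<open>sup\<^sub>x \<bar>h x\<bar> \<le> c\<close> is written as \<open>\<forall>x. \<bar>h x\<bar> \<le> c\<close>, since the
  supremum operator on the reals is unspecified on unbounded sets.
\<close>

definition geom_unif_ergodic ::
    "(nat \<Rightarrow> ('a \<Rightarrow> real) \<Rightarrow> 'a \<Rightarrow> real) \<Rightarrow> ('a \<Rightarrow> real) \<Rightarrow> bool" where
  "geom_unif_ergodic Q \<nu> \<longleftrightarrow>
     (\<exists>C>0. \<exists>\<rho>. 0 < \<rho> \<and> \<rho> < 1 \<and>
       (\<forall>\<^sub>F n in sequentially. \<forall>f\<in>l1 \<nu>. \<forall>x.
          \<bar>Q n f x - mean \<nu> f\<bar> \<le> C * \<rho> ^ n * l1_norm \<nu> f))"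

definition geom_unif_quasi_ergodic ::
    "(nat \<Rightarrow> ('a \<Rightarrow> real) \<Rightarrow> 'a \<Rightarrow> real) \<Rightarrow> ('a \<Rightarrow> real) \<Rightarrow> bool" where
  "geom_unif_quasi_ergodic U m \<longleftrightarrow>
     (\<exists>C>0. \<exists>\<rho>. 0 < \<rho> \<and> \<rho> < 1 \<and>
       (\<forall>\<^sub>F n in sequentially. \<forall>f\<in>l1 m. \<forall>x.
          \<bar>U n f x / U n (\<lambda>_. 1) x - (\<Sum>\<^sub>\<infinity>y. f y * m y)\<bar> \<le> C * \<rho> ^ n * l1_norm m f))"

end

theory Submission
  imports Defs
begin

text \<open>
  The Doob transform \<open>q(x,y) = k(x,y) \<phi>(y) / (lam \<phi>(x))\<close> of the kernel \<open>k\<close> of \<open>opU P V\<close> is a strictly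
  positive Markov kernel with finite invariant measure \<open>\<nu>\<close>; its powers are the intrinsic semigroup,
  and the dual construction gives its adjoint with respect to \<open>\<nu>\<close>. Condition (a) says that some power
  has a bounded density, which is symmetric under duality. A bounded density forces the chain into a
  fixed finite set with probability at least \<open>1/2\<close>; there \<open>q\<close> is bounded below at a point, so Doeblin's
  condition holds and oscillations contract geometrically, which is (b). With \<open>h = 1/\<phi>\<close>, condition (c)
  concerns the quotients \<open>Q\<^sub>n g / Q\<^sub>n h\<close>. Under (b) the inequalities \<open>c \<nu>(g) \<le> Q\<^sub>n g \<le> K\<^sup>n h\<close> for \<open>0 \<le> g \<le> h\<close>
  give \<open>\<nu>(h) < \<infinity>\<close>, and (c) follows; conversely \<open>g = 1\<close> in (c) bounds \<open>Q\<^sub>n h\<close> and hence gives (a).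
\<close>

section \<open>Weighted summability and geometric rates\<close>

text \<open>Summability is unconditional here, hence absolute for real functions, and a positive
  weight passes through the norm.\<close>

lemma l1_real_iff:
  fixes f :: "'a \<Rightarrow> real"
  assumes "\<And>x. 0 < w x"
  shows "f \<in> l1 w \<longleftrightarrow> (\<lambda>x. f x * w x) summable_on UNIV"
proof -
  have "(\<lambda>x. norm (f x) * w x) = (\<lambda>x. norm (f x * w x))"
    using assms by (auto simp: abs_mult less_imp_le)
  then show ?thesis
    by (simp add: l1_def summable_on_iff_abs_summable_on_real[of "\<lambda>x. f x * w x"])
qed

lemma l1_dominated:
  fixes f g :: "'a \<Rightarrow> real"
  assumes "\<And>x. 0 < w x" "g \<in> l1 w" "\<And>x. \<bar>f x\<bar> \<le> g x"
  shows "f \<in> l1 w"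
proof -
  have "(\<lambda>x. g x * w x) summable_on UNIV"
    using assms l1_real_iff by blast
  then show ?thesis
    unfolding l1_def mem_Collect_eq
    by (rule summable_on_comparison_test) (use assms in \<open>auto simp: less_imp_le intro!: mult_right_mono\<close>)
qed

lemma l1_norm_nonneg:
  assumes "\<And>x. 0 < w x"
  shows "0 \<le> l1_norm w f"
  unfolding l1_norm_def using assms by (intro infsum_nonneg) (simp add: less_imp_le)

text \<open>For integrable \<open>f\<close> this is the triangle inequality; otherwise the signed
  sum takes its default value 0, and the bound persists.\<close>

lemma abs_infsum_le_l1_norm:
  fixes f :: "'a \<Rightarrow> real"
  assumes "\<And>x. 0 < w x"
  shows "\<bar>\<Sum>\<^sub>\<infinity>x. f x * w x\<bar> \<le> l1_norm w f"
proof (cases "f \<in> l1 w")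
  case True
  have eq: "(\<lambda>x. norm (f x * w x)) = (\<lambda>x. norm (f x) * w x)"
    using assms by (auto simp: abs_mult less_imp_le)
  show ?thesis
    using norm_infsum_bound[of "\<lambda>x. f x * w x" UNIV] True unfolding eq l1_norm_def l1_def by simp
next
  case False
  then have "(\<Sum>\<^sub>\<infinity>x. f x * w x) = 0"
    using assms l1_real_iff infsum_not_exists by blast
  then show ?thesis
    using l1_norm_nonneg[of w f] assms by simp
qed

text \<open>This turns decay by \<theta> per block of \<open>N\<close> steps into a rate per step.
  The rate is the \<open>N\<close>-th root of \<theta>; the incomplete last block costs at most the
  factor \<open>1 / \<theta>\<close>.\<close>

lemma geometric_floor_bound:
  fixes \<theta> :: real
  assumes "0 < \<theta>" "\<theta> < 1" "0 < N"
  obtains \<rho> where "0 < \<rho>" "\<rho> < 1" "\<And>n. \<theta> ^ (n div N) \<le> \<rho> ^ n / \<theta>"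
proof
  show "0 < root N \<theta>" "root N \<theta> < 1"
    using assms by auto
  fix n
  have "\<theta> ^ (n div N) * \<theta> \<le> \<theta> ^ (n div N) * root N \<theta> ^ (n mod N)"
  proof (rule mult_left_mono)
    have "\<theta> = root N \<theta> ^ N"
      using assms by simp
    also have "\<dots> \<le> root N \<theta> ^ (n mod N)"
      using assms by (intro power_decreasing) (auto simp: less_imp_le)
    finally show "\<theta> \<le> root N \<theta> ^ (n mod N)" .
  qed (use assms in simp)
  also have "\<dots> = (root N \<theta> ^ N) ^ (n div N) * root N \<theta> ^ (n mod N)"
    using assms by simp
  also have "\<dots> = root N \<theta> ^ n"
    by (metis div_mult_mod_eq mult.commute power_add power_mult)
  finally show "\<theta> ^ (n div N) \<le> root N \<theta> ^ n / \<theta>"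
    using assms by (simp add: field_simps)
qed

section \<open>Markov kernels in duality with respect to a finite measure\<close>

definition kernel_op :: "('a \<Rightarrow> 'a \<Rightarrow> real) \<Rightarrow> ('a \<Rightarrow> real) \<Rightarrow> 'a \<Rightarrow> real" where
  "kernel_op q f x = (\<Sum>\<^sub>\<infinity>y. q x y * f y)"

text \<open>\<open>balance\<close> makes \<open>qh\<close> the adjoint of \<open>q\<close> with
  respect to \<nu>. Summing it over \<open>x\<close> shows that the unit row sums of
  \<open>qh\<close> encode the invariance of \<nu> under \<open>q\<close>; the dual statement holds
  likewise.\<close>

locale dual_markov_pair =
  fixes q qh :: "'a \<Rightarrow> 'a \<Rightarrow> real" and \<nu> :: "'a \<Rightarrow> real"
  assumes q_pos: "0 < q x y"
    and q_sum: "(q x has_sum 1) UNIV"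
    and qh_sum: "(qh x has_sum 1) UNIV"
    and \<nu>_pos: "0 < \<nu> x"
    and \<nu>_summable: "\<nu> summable_on UNIV"
    and balance: "\<nu> x * q x y = \<nu> y * qh y x"
begin

lemma qh_pos: "0 < qh x y"
  by (metis q_pos \<nu>_pos balance mult_pos_pos zero_less_mult_pos)

lemma dual: "dual_markov_pair qh q \<nu>"
  using qh_pos q_sum qh_sum \<nu>_pos \<nu>_summable balance by unfold_locales metis+

abbreviation Q :: "nat \<Rightarrow> ('a \<Rightarrow> real) \<Rightarrow> 'a \<Rightarrow> real" where
  "Q n \<equiv> kernel_op q ^^ n"

abbreviation total :: real where
  "total \<equiv> (\<Sum>\<^sub>\<infinity>x. \<nu> x)"

lemma total_pos: "0 < total"
proof -
  have "\<nu> undefined \<le> total"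
    using finite_sum_le_infsum[of \<nu> UNIV "{undefined}"] \<nu>_summable \<nu>_pos by (simp add: less_imp_le)
  then show ?thesis
    using \<nu>_pos[of undefined] by simp
qed

lemma l1_iff: "(f :: 'a \<Rightarrow> real) \<in> l1 \<nu> \<longleftrightarrow> (\<lambda>x. f x * \<nu> x) summable_on UNIV"
  by (rule l1_real_iff[OF \<nu>_pos])

lemma l1_bounded:
  assumes "\<And>x. \<bar>f x\<bar> \<le> (B::real)"
  shows "f \<in> l1 \<nu>"
proof (rule l1_dominated[OF \<nu>_pos _ assms])
  show "(\<lambda>_. B) \<in> l1 \<nu>"
    unfolding l1_iff using \<nu>_summable by (rule summable_on_cmult_right)
qed

lemma l1_scale: "f \<in> l1 \<nu> \<Longrightarrow> (\<lambda>x. c * f x :: real) \<in> l1 \<nu>"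
  unfolding l1_iff by (simp add: mult.assoc summable_on_cmult_right)

section \<open>Fubini and the action on integrable functions\<close>

text \<open>This is the absolute convergence that later exchanges of sums require. Each row of
  \<open>qh\<close> is a probability, so the inner sum is at most \<open>B\<close>, which leaves
  \<open>B\<close> times the norm of \<open>f\<close>.\<close>

lemma l1_pairing_summable:
  fixes f g :: "'a \<Rightarrow> real"
  assumes f: "f \<in> l1 \<nu>" and g: "\<And>x. \<bar>g x\<bar> \<le> B"
  shows "(\<lambda>p. norm (case p of (y, x) \<Rightarrow> f y * \<nu> y * (qh y x * g x))) summable_on (UNIV \<times> UNIV)"
proof (rule Infinite_Sum.abs_summable_on_Sigma_iff[THEN iffD2], intro conjI ballI)
  have B: "0 \<le> B"
    using g[of undefined] by simp
  have 1: "(\<lambda>x. norm (qh y x * g x)) summable_on UNIV" for y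
  proof (rule summable_on_comparison_test)
    show "(\<lambda>x. B * qh y x) summable_on UNIV"
      using qh_sum by (intro summable_on_cmult_right) (auto simp: summable_on_def)
    show "norm (qh y x * g x) \<le> B * qh y x" for x
      using mult_left_mono[OF g, of "qh y x" x] qh_pos[of y x] by (simp add: abs_mult mult.commute)
  qed auto
  have 2: "(\<Sum>\<^sub>\<infinity>x. norm (qh y x * g x)) \<le> B" for y
  proof -
    have "(\<Sum>\<^sub>\<infinity>x. norm (qh y x * g x)) \<le> (\<Sum>\<^sub>\<infinity>x. B * qh y x)"
    proof (rule infsum_mono[OF 1])
      show "(\<lambda>x. B * qh y x) summable_on UNIV"
        using qh_sum by (intro summable_on_cmult_right) (auto simp: summable_on_def)
      show "norm (qh y x * g x) \<le> B * qh y x" for x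
        using mult_left_mono[OF g, of "qh y x" x] qh_pos[of y x] by (simp add: abs_mult mult.commute)
    qed
    also have "\<dots> = B"
      using infsumI[OF qh_sum[of y]] by (simp add: infsum_cmult_right')
    finally show ?thesis .
  qed
  show "(\<lambda>x. norm (case (y, x) of (y, x) \<Rightarrow> f y * \<nu> y * (qh y x * g x))) summable_on UNIV" for y
    using summable_on_cmult_right[OF 1[of y], of "\<bar>f y * \<nu> y\<bar>"] by (simp add: abs_mult mult.assoc)
  have "(\<lambda>y. B * (norm (f y) * \<nu> y)) summable_on UNIV"
    using f unfolding l1_def by (auto intro: summable_on_cmult_right)
  then have "(\<lambda>y. (norm (f y) * \<nu> y) * (\<Sum>\<^sub>\<infinity>x. norm (qh y x * g x))) summable_on UNIV"
  proof (rule summable_on_comparison_test)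
    fix y
    show "norm (f y) * \<nu> y * (\<Sum>\<^sub>\<infinity>x. norm (qh y x * g x)) \<le> B * (norm (f y) * \<nu> y)"
      using mult_left_mono[OF 2[of y], of "norm (f y) * \<nu> y"] \<nu>_pos[of y]
      by (simp add: mult.commute)
    show "0 \<le> norm (f y) * \<nu> y * (\<Sum>\<^sub>\<infinity>x. norm (qh y x * g x))"
      using \<nu>_pos[of y] by (intro mult_nonneg_nonneg infsum_nonneg) (auto simp: less_imp_le)
  qed
  moreover have "(\<Sum>\<^sub>\<infinity>x. norm (f y * \<nu> y * (qh y x * g x)))
      = norm (f y) * \<nu> y * (\<Sum>\<^sub>\<infinity>x. norm (qh y x * g x))" for y
    using \<nu>_pos[of y] by (subst infsum_cmult_right'[symmetric]) (simp add: abs_mult mult.assoc)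
  ultimately have "(\<lambda>y. \<Sum>\<^sub>\<infinity>x. norm (f y * \<nu> y * (qh y x * g x))) summable_on UNIV"
    by simp
  then show "(\<lambda>y. norm (\<Sum>\<^sub>\<infinity>x. norm (case (y, x) of (y, x) \<Rightarrow> f y * \<nu> y * (qh y x * g x))))
      summable_on UNIV"
    unfolding prod.case by (rule summable_on_iff_abs_summable_on_real[THEN iffD1])
qed

text \<open>\<open>balance\<close> rewrites the double sum with \<open>q\<close> as one with
  \<open>qh\<close>, and Fubini exchanges the order.\<close>

lemma kernel_op_pairing:
  fixes f g :: "'a \<Rightarrow> real"
  assumes f: "f \<in> l1 \<nu>" and g: "\<And>x. \<bar>g x\<bar> \<le> B"
  shows "(\<Sum>\<^sub>\<infinity>x. kernel_op q f x * g x * \<nu> x) = (\<Sum>\<^sub>\<infinity>y. f y * kernel_op qh g y * \<nu> y)"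
proof -
  let ?F = "\<lambda>y x. f y * \<nu> y * (qh y x * g x)"
  have eq: "?F y x = (g x * \<nu> x) * (q x y * f y)" for x y
    using balance[of x y] by (simp add: algebra_simps)
  have sw: "(\<Sum>\<^sub>\<infinity>x. \<Sum>\<^sub>\<infinity>y. ?F y x) = (\<Sum>\<^sub>\<infinity>y. \<Sum>\<^sub>\<infinity>x. ?F y x)"
    using abs_summable_summable[OF l1_pairing_summable[OF f g]]
    by (intro infsum_swap_banach[symmetric]) simp
  have "(\<Sum>\<^sub>\<infinity>x. kernel_op q f x * g x * \<nu> x) = (\<Sum>\<^sub>\<infinity>x. \<Sum>\<^sub>\<infinity>y. ?F y x)"
    unfolding eq infsum_cmult_right' kernel_op_def by (simp add: mult_ac)
  also have "\<dots> = (\<Sum>\<^sub>\<infinity>y. f y * kernel_op qh g y * \<nu> y)"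
    unfolding sw infsum_cmult_right' kernel_op_def by (simp add: mult_ac)
  finally show ?thesis .
qed

text \<open>By \<open>balance\<close> and \<open>qh y x \<le> 1\<close>, the row \<open>q x\<close>
  is dominated by \<open>\<nu> / \<nu> x\<close>.\<close>

lemma q_summable:
  assumes f: "f \<in> l1 \<nu>"
  shows "(\<lambda>y. q x y * f y) summable_on UNIV"
proof -
  have qh_le: "qh y x \<le> 1" for y
    using finite_sum_le_has_sum[OF qh_sum, of "{x}" y] qh_pos by (auto simp: less_imp_le)
  have "(\<lambda>y. (1 / \<nu> x) * (norm (f y) * \<nu> y)) summable_on UNIV"
    using f unfolding l1_def by (intro summable_on_cmult_right) auto
  then have "(\<lambda>y. norm (q x y * f y)) summable_on UNIV"
  proof (rule summable_on_comparison_test)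
    fix y
    have "q x y = \<nu> y * qh y x / \<nu> x"
      using balance[of x y] \<nu>_pos[of x] by (simp add: field_simps)
    also have "\<dots> \<le> \<nu> y / \<nu> x"
      using qh_le[of y] \<nu>_pos[of x] \<nu>_pos[of y] by (simp add: divide_right_mono mult_left_le)
    finally show "norm (q x y * f y) \<le> (1 / \<nu> x) * (norm (f y) * \<nu> y)"
      using q_pos[of x y] mult_left_mono[of "q x y" "\<nu> y / \<nu> x" "\<bar>f y\<bar>"]
      by (simp add: abs_mult mult_ac)
  qed auto
  then show ?thesis
    by (rule abs_summable_summable)
qed

text \<open>The case \<open>g = 1\<close> of the joint summability makes the marginal over
  \<open>x\<close> summable, and \<open>balance\<close> identifies that marginal.\<close>

lemma kernel_op_l1:
  assumes f: "f \<in> l1 \<nu>"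
  shows "kernel_op q f \<in> l1 \<nu>"
proof -
  have "(\<lambda>(y, x). f y * \<nu> y * qh y x) summable_on (UNIV \<times> UNIV)"
    using abs_summable_summable[OF l1_pairing_summable[OF f, of "\<lambda>_. 1" 1]] by simp
  then have "(\<lambda>(x, y). f y * \<nu> y * qh y x) summable_on (UNIV \<times> UNIV)"
    by (subst summable_on_swap) (simp add: case_prod_unfold)
  then have "(\<lambda>x. \<Sum>\<^sub>\<infinity>y. f y * \<nu> y * qh y x) summable_on UNIV"
    using summable_on_Sigma_banach[of "\<lambda>x y. f y * \<nu> y * qh y x" UNIV "\<lambda>_. UNIV"] by simp
  moreover have "(\<Sum>\<^sub>\<infinity>y. f y * \<nu> y * qh y x) = kernel_op q f x * \<nu> x" for x
  proof -
    have "f y * \<nu> y * qh y x = q x y * f y * \<nu> x" for y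
      using balance[of x y] by (simp add: algebra_simps)
    then show ?thesis
      unfolding kernel_op_def by (simp only: infsum_cmult_left')
  qed
  ultimately show ?thesis
    by (simp add: l1_iff)
qed

section \<open>Iterates of the Markov operator\<close>

lemma Q_l1: "f \<in> l1 \<nu> \<Longrightarrow> Q n f \<in> l1 \<nu>"
  by (induction n) (auto intro: kernel_op_l1)

lemma kernel_op_scale: "kernel_op q (\<lambda>x. c * f x) = (\<lambda>x. c * kernel_op q f x)"
  by (simp add: kernel_op_def fun_eq_iff mult.left_commute infsum_cmult_right')

lemma kernel_op_const: "kernel_op q (\<lambda>_. c) = (\<lambda>_. c)"
  using infsumI[OF q_sum] by (simp add: kernel_op_def fun_eq_iff infsum_cmult_left')

lemma kernel_op_add:
  assumes "f \<in> l1 \<nu>" "g \<in> l1 \<nu>"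
  shows "kernel_op q (\<lambda>x. f x + g x) = (\<lambda>x. kernel_op q f x + kernel_op q g x)"
  using infsum_add[OF q_summable[OF assms(1)] q_summable[OF assms(2)]]
  by (simp add: kernel_op_def fun_eq_iff distrib_left)

lemma kernel_op_mono:
  assumes "f \<in> l1 \<nu>" "g \<in> l1 \<nu>" "\<And>x. f x \<le> g x"
  shows "kernel_op q f x \<le> kernel_op q g x"
  unfolding kernel_op_def
  by (intro infsum_mono q_summable mult_left_mono) (use assms q_pos in \<open>auto simp: less_imp_le\<close>)

lemma Q_add:
  assumes "f \<in> l1 \<nu>" "g \<in> l1 \<nu>"
  shows "Q n (\<lambda>x. f x + g x) = (\<lambda>x. Q n f x + Q n g x)"
  by (induction n) (simp_all add: kernel_op_add Q_l1 assms)

lemma Q_scale: "Q n (\<lambda>x. c * f x) = (\<lambda>x. c * Q n f x)"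
  by (induction n) (simp_all add: kernel_op_scale)

lemma Q_const: "Q n (\<lambda>_. c) = (\<lambda>_. c)"
  by (induction n) (simp_all add: kernel_op_const)

lemma Q_mono:
  assumes "f \<in> l1 \<nu>" "g \<in> l1 \<nu>" "\<And>x. f x \<le> g x"
  shows "Q n f x \<le> Q n g x"
  using assms by (induction n arbitrary: x) (simp_all add: kernel_op_mono Q_l1)

lemma Q_affine:
  assumes "f \<in> l1 \<nu>"
  shows "Q n (\<lambda>x. a + c * f x) x = a + c * Q n f x"
  using Q_add[OF l1_bounded[of "\<lambda>_. a" "\<bar>a\<bar>"] l1_scale[OF assms]] by (simp add: Q_const Q_scale)

lemma Q_bounds:
  assumes "\<And>x. l \<le> f x" "\<And>x. f x \<le> u"
  shows "l \<le> Q n f x" "Q n f x \<le> u"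
proof -
  have f: "f \<in> l1 \<nu>"
    by (rule l1_bounded[of f "max \<bar>l\<bar> \<bar>u\<bar>"]) (use assms in \<open>smt (verit)\<close>)
  show "l \<le> Q n f x"
    using Q_mono[OF l1_bounded[of "\<lambda>_. l" "\<bar>l\<bar>"] f] assms by (simp add: Q_const)
  show "Q n f x \<le> u"
    using Q_mono[OF f l1_bounded[of "\<lambda>_. u" "\<bar>u\<bar>"]] assms by (simp add: Q_const)
qed

text \<open>One step is the pairing with the constant 1, which the Markov kernel \<open>qh\<close>
  fixes.\<close>

lemma Q_invariant:
  assumes "f \<in> l1 \<nu>"
  shows "(\<Sum>\<^sub>\<infinity>x. Q n f x * \<nu> x) = (\<Sum>\<^sub>\<infinity>x. f x * \<nu> x)"
proof (induction n)
  case (Suc n)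
  have "kernel_op qh (\<lambda>_. 1) y = 1" for y
    using infsumI[OF qh_sum[of y]] by (simp add: kernel_op_def)
  then show ?case
    using kernel_op_pairing[OF Q_l1[OF assms, of n], of "\<lambda>_. 1" 1] Suc by simp
qed simp

lemma Q_pairing:
  fixes f g :: "'a \<Rightarrow> real"
  assumes "f \<in> l1 \<nu>" "\<And>x. \<bar>g x\<bar> \<le> B"
  shows "(\<Sum>\<^sub>\<infinity>x. Q n f x * g x * \<nu> x) = (\<Sum>\<^sub>\<infinity>x. f x * (kernel_op qh ^^ n) g x * \<nu> x)"
  using assms
proof (induction n arbitrary: f)
  case (Suc n)
  interpret d: dual_markov_pair qh q \<nu>
    by (rule dual)
  have "\<bar>(kernel_op qh ^^ n) g x\<bar> \<le> B" for x
    using d.Q_bounds[of "-B" g B n x] Suc.prems(2) by (simp add: abs_le_iff minus_le_iff)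
  note b = kernel_op_pairing[OF Suc.prems(1) this]
  \<comment> \<open>The innermost factor is absorbed into \<open>f\<close>, which is why the
    induction generalizes over \<open>f\<close>; the remaining \<open>n\<close> factors move by the
    induction hypothesis, the last one by the one-step pairing.\<close>
  have "(\<Sum>\<^sub>\<infinity>x. Q (Suc n) f x * g x * \<nu> x) = (\<Sum>\<^sub>\<infinity>x. Q n (kernel_op q f) x * g x * \<nu> x)"
    by (simp add: funpow_swap1)
  also have "\<dots> = (\<Sum>\<^sub>\<infinity>x. f x * (kernel_op qh ^^ Suc n) g x * \<nu> x)"
    using Suc.IH[OF kernel_op_l1[OF Suc.prems(1)] Suc.prems(2)] b by simp
  finally show ?case .
qed simp

lemma mean_bounds:
  assumes "\<And>x. l \<le> f x" "\<And>x. f x \<le> u"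
  shows "l \<le> mean \<nu> f" "mean \<nu> f \<le> u"
proof -
  have "f \<in> l1 \<nu>"
    by (rule l1_bounded[of f "max \<bar>l\<bar> \<bar>u\<bar>"]) (use assms in \<open>smt (verit)\<close>)
  then have f: "(\<lambda>x. f x * \<nu> x) summable_on UNIV"
    by (simp add: l1_iff)
  have "l * total \<le> (\<Sum>\<^sub>\<infinity>x. f x * \<nu> x)"
    using infsum_mono[OF summable_on_cmult_right[OF \<nu>_summable] f] assms \<nu>_pos
    by (simp add: infsum_cmult_right' mult_right_mono less_imp_le)
  moreover have "(\<Sum>\<^sub>\<infinity>x. f x * \<nu> x) \<le> u * total"
    using infsum_mono[OF f summable_on_cmult_right[OF \<nu>_summable]] assms \<nu>_pos
    by (simp add: infsum_cmult_right' mult_right_mono less_imp_le)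
  ultimately show "l \<le> mean \<nu> f" "mean \<nu> f \<le> u"
    using total_pos by (auto simp: mean_def field_simps)
qed

section \<open>Ultraboundedness, Doeblin minorization and uniform ergodicity\<close>

definition ultrabounded :: bool where
  "ultrabounded \<longleftrightarrow> (\<exists>n\<ge>1. bounded_l1_linf \<nu> (Q n))"

text \<open>The constant is enlarged to \<open>\<bar>C\<bar> + 1\<close> because a positive one is
  needed as a divisor.\<close>

lemma ultraboundedE:
  assumes "ultrabounded"
  obtains n C where "1 \<le> n" "0 < C" "\<And>f x. f \<in> l1 \<nu> \<Longrightarrow> \<bar>Q n f x\<bar> \<le> C * l1_norm \<nu> f"
proof -
  obtain n C where n: "1 \<le> n" and C: "\<And>f x. f \<in> l1 \<nu> \<Longrightarrow> \<bar>Q n f x\<bar> \<le> C * l1_norm \<nu> f"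
    using assms \<nu>_pos unfolding ultrabounded_def bounded_l1_linf_def by (metis less_irrefl)
  have "\<bar>Q n f x\<bar> \<le> (\<bar>C\<bar> + 1) * l1_norm \<nu> f" if "f \<in> l1 \<nu>" for f x
    using C[OF that, of x] mult_right_mono[of C "\<bar>C\<bar> + 1" "l1_norm \<nu> f"]
      l1_norm_nonneg[of \<nu> f, OF \<nu>_pos] by linarith
  with that[of n "\<bar>C\<bar> + 1"] n show ?thesis by simp
qed

lemma Q_split: "Q (m + n) f = Q m (Q n f)"
  by (simp add: funpow_add)

text \<open>
  Ultraboundedness makes \<open>Q n\<close> small on indicators of sets of small \<open>\<nu>\<close>-mass, so from any starting
  point the chain is after \<open>n\<close> steps in a fixed finite set with probability at least \<open>1/2\<close>.
\<close>

lemma ultrabounded_tight: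
  assumes "ultrabounded"
  obtains n F where "finite F" "\<And>x. 1 / 2 \<le> Q n (indicator F) x"
proof -
  obtain n C where C: "0 < C" "\<And>f x. f \<in> l1 \<nu> \<Longrightarrow> \<bar>Q n f x\<bar> \<le> C * l1_norm \<nu> f"
    using ultraboundedE[OF assms] by metis
  \<comment> \<open>The tolerance is chosen so that \<open>C\<close> times the mass outside
    \<open>F\<close> is at most \<open>1 / 2\<close>.\<close>
  obtain F where F: "finite F" "dist (sum \<nu> F) total \<le> 1 / (2 * C)"
    using infsum_finite_approximation[OF \<nu>_summable, of "1 / (2 * C)"] C by auto
  have l1: "(indicator A :: 'a \<Rightarrow> real) \<in> l1 \<nu>" for A
    by (rule l1_bounded[of _ 1]) (simp add: indicator_def)
  have "total = sum \<nu> F + (\<Sum>\<^sub>\<infinity>x\<in>-F. \<nu> x)"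
    using infsum_Un_disjoint[of \<nu> F "-F"] F summable_on_subset_banach[OF \<nu>_summable, of "-F"]
    by (simp add: Compl_partition)
  moreover have "l1_norm \<nu> (indicator (-F) :: 'a \<Rightarrow> real) = (\<Sum>\<^sub>\<infinity>x\<in>-F. \<nu> x)"
    unfolding l1_norm_def by (rule infsum_cong_neutral) auto
  ultimately have small: "l1_norm \<nu> (indicator (-F) :: 'a \<Rightarrow> real) \<le> 1 / (2 * C)"
    using F by (simp add: dist_real_def)
  have "1 / 2 \<le> Q n (indicator F) x" for x
  proof -
    have "C * l1_norm \<nu> (indicator (-F) :: 'a \<Rightarrow> real) \<le> 1 / 2"
      using mult_left_mono[OF small, of C] C by simp
    then have "Q n (indicator (-F)) x \<le> 1 / 2"
      using C(2)[OF l1[of "-F"], of x] by simp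
    moreover have "Q n (\<lambda>x. indicator F x + indicator (-F) x) x = Q n (indicator F) x + Q n (indicator (-F)) x"
      using Q_add[OF l1 l1] by simp
    moreover have "(\<lambda>x. indicator F x + indicator (-F) x) = (\<lambda>_. 1 :: real)"
      by (auto simp: indicator_def)
    ultimately show ?thesis
      by (simp add: Q_const)
  qed
  with F(1) show ?thesis by (rule that)
qed

text \<open>Doeblin's condition with a point mass as minorizing measure: after \<open>n\<close>
  steps the chain is in the finite set \<open>F\<close> with probability at least
  \<open>1 / 2\<close>, and one further step from \<open>F\<close> hits \<open>y\<close> with
  probability at least \<epsilon>. Hence \<open>N = Suc n\<close> and
  \<open>\<delta> = \<epsilon> / 2\<close>.\<close>

lemma ultrabounded_minorization:
  assumes "ultrabounded"
  obtains N \<delta> y where "0 < N" "0 < \<delta>" "\<delta> < 1"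
    "\<And>g B x. (\<And>x. 0 \<le> g x) \<Longrightarrow> (\<And>x. g x \<le> B) \<Longrightarrow> \<delta> * g y \<le> Q N g x"
proof -
  obtain n F where F: "finite F" "\<And>x. 1 / 2 \<le> Q n (indicator F) x"
    using ultrabounded_tight[OF assms] by metis
  \<comment> \<open>Any fixed point serves, since \<open>q\<close> is positive everywhere.\<close>
  define y :: 'a where "y = undefined"
  \<comment> \<open>A minimum over a finite set stays positive. Including 1 keeps that set nonempty
    and gives \<open>\<epsilon> \<le> 1\<close>, hence \<open>\<delta> < 1\<close>.\<close>
  define \<epsilon> where "\<epsilon> = Min (insert 1 ((\<lambda>z. q z y) ` F))"
  have \<epsilon>: "0 < \<epsilon>" "\<epsilon> \<le> 1" "\<And>z. z \<in> F \<Longrightarrow> \<epsilon> \<le> q z y"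
    using F(1) q_pos by (auto simp: \<epsilon>_def)
  have l1: "(indicator A :: 'a \<Rightarrow> real) \<in> l1 \<nu>" for A
    by (rule l1_bounded[of _ 1]) (simp add: indicator_def)
  have minor: "\<epsilon> / 2 * g y \<le> Q (Suc n) g x"
    if g: "\<And>x. 0 \<le> g x" "\<And>x. g x \<le> B" for g B x
  proof -
    have gl1: "g \<in> l1 \<nu>"
      by (rule l1_bounded[of _ B]) (use g in simp)
    have step: "\<epsilon> * g y * indicator F z \<le> kernel_op q g z" for z
    proof (cases "z \<in> F")
      case True
      have "q z y * g y \<le> kernel_op q g z"
        using finite_sum_le_infsum[OF q_summable[OF gl1], of "{y}" z] g q_pos
        by (simp add: kernel_op_def less_imp_le)
      then show ?thesis
        using mult_right_mono[OF \<epsilon>(3)[OF True] g(1)[of y]] True by simp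
    next
      case False
      then show ?thesis
        using infsum_nonneg[of UNIV "\<lambda>y. q z y * g y"] g q_pos by (simp add: kernel_op_def less_imp_le)
    qed
    have "\<epsilon> * g y * (1 / 2) \<le> \<epsilon> * g y * Q n (indicator F) x"
      using F(2) \<epsilon>(1) g(1) by (intro mult_left_mono) auto
    also have "\<dots> = Q n (\<lambda>z. \<epsilon> * g y * indicator F z) x"
      by (simp add: Q_scale)
    also have "\<dots> \<le> Q n (kernel_op q g) x"
      by (intro Q_mono l1_scale l1 kernel_op_l1 gl1 step)
    finally show ?thesis
      by (simp add: funpow_swap1)
  qed
  show ?thesis
  proof (rule that[of "Suc n" "\<epsilon> / 2" y])
    show "\<epsilon> / 2 * g y \<le> Q (Suc n) g x" if "\<And>x. 0 \<le> g x" "\<And>x. g x \<le> B" for g B x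
      using minor that by blast
  qed (use \<epsilon> in auto)
qed

text \<open>
  The minorization confines \<open>Q N f\<close> to an interval of length \<open>(1 - \<delta>) (u - l)\<close>
  located by the value \<open>f y\<close>.
\<close>

lemma ultrabounded_contraction:
  assumes "ultrabounded"
  obtains N \<theta> where "0 < N" "0 < \<theta>" "\<theta> < 1"
    "\<And>f l u n x. (\<And>x. l \<le> f x) \<Longrightarrow> (\<And>x. f x \<le> u) \<Longrightarrow>
       \<bar>Q n f x - mean \<nu> f\<bar> \<le> \<theta> ^ (n div N) * (u - l)"
proof -
  obtain N \<delta> y where N: "0 < N" and \<delta>: "0 < \<delta>" "\<delta> < 1"
    and minor: "\<And>g B x. (\<And>x. 0 \<le> g x) \<Longrightarrow> (\<And>x. g x \<le> B) \<Longrightarrow> \<delta> * g y \<le> Q N g x"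
    using ultrabounded_minorization[OF assms] by metis
  have step: "\<exists>l'. \<forall>x. l' \<le> Q N f x \<and> Q N f x \<le> l' + (1 - \<delta>) * (u - l)"
    if b: "\<And>x. l \<le> f x" "\<And>x. f x \<le> u" for f l u
  proof (intro exI allI conjI)
    fix x
    have f: "f \<in> l1 \<nu>"
      by (rule l1_bounded[of f "max \<bar>l\<bar> \<bar>u\<bar>"]) (use b in \<open>smt (verit)\<close>)
    \<comment> \<open>The minorization is applied to \<open>f - l\<close> for the lower end and
      below to \<open>u - f\<close> for the upper end, both written in the affine form that
      \<open>Q_affine\<close> expects. The ends differ by
      \<open>(1 - \<delta>) * (u - l)\<close>.\<close>
    have "\<delta> * (- l + 1 * f y) \<le> Q N (\<lambda>x. - l + 1 * f x) x"
      by (rule minor[of _ "u - l"]) (use b in auto)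
    then show "l + \<delta> * (f y - l) \<le> Q N f x"
      unfolding Q_affine[OF f] by simp
    have "\<delta> * (u + (- 1) * f y) \<le> Q N (\<lambda>x. u + (- 1) * f x) x"
      by (rule minor[of _ "u - l"]) (use b in auto)
    then show "Q N f x \<le> l + \<delta> * (f y - l) + (1 - \<delta>) * (u - l)"
      unfolding Q_affine[OF f] by (simp add: algebra_simps)
  qed
  have iter: "\<exists>l'. \<forall>x. l' \<le> Q (k * N) f x \<and> Q (k * N) f x \<le> l' + (1 - \<delta>) ^ k * (u - l)"
    if b: "\<And>x. l \<le> f x" "\<And>x. f x \<le> u" for f l u k
  proof (induction k)
    case 0
    then show ?case using b by (intro exI[of _ l]) simp
  next
    case (Suc k)
    then obtain l' where "\<And>x. l' \<le> Q (k * N) f x"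
      "\<And>x. Q (k * N) f x \<le> l' + (1 - \<delta>) ^ k * (u - l)"
      by blast
    from step[OF this] show ?case
      by (simp add: Q_split mult.assoc)
  qed
  have "\<bar>Q n f x - mean \<nu> f\<bar> \<le> (1 - \<delta>) ^ (n div N) * (u - l)"
    if b: "\<And>x. l \<le> f x" "\<And>x. f x \<le> u" for f l u n x
  proof -
    obtain l' where l': "\<And>x. l' \<le> Q (n div N * N) f x"
      "\<And>x. Q (n div N * N) f x \<le> l' + (1 - \<delta>) ^ (n div N) * (u - l)"
      using iter[of l f u "n div N", OF b] by blast
    have "n = n mod N + n div N * N"
      by simp
    then have eq: "Q n f = Q (n mod N) (Q (n div N * N) f)"
      by (metis Q_split)
    have f: "f \<in> l1 \<nu>"
      by (rule l1_bounded[of f "max \<bar>l\<bar> \<bar>u\<bar>"]) (use b in \<open>smt (verit)\<close>)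
    \<comment> \<open>The mean is invariant, so it lies in the same interval as
      \<open>Q n f x\<close>; two points of an interval differ by at most its length.\<close>
    have "mean \<nu> f = mean \<nu> (Q (n div N * N) f)"
      by (simp only: mean_def Q_invariant[OF f])
    then show ?thesis
      using mean_bounds[of l' "Q (n div N * N) f", OF l']
        Q_bounds[of l' "Q (n div N * N) f" _ "n mod N" x, OF l']
      unfolding eq by linarith
  qed
  then show ?thesis
    using that[of N "1 - \<delta>"] N \<delta> by simp
qed

lemma mean_le: "\<bar>mean \<nu> f\<bar> \<le> l1_norm \<nu> f / total"
  unfolding mean_def abs_mult
  using abs_infsum_le_l1_norm[of \<nu> f, OF \<nu>_pos] total_pos by (simp add: divide_right_mono)

text \<open>The first \<open>n0\<close> steps bring \<open>f\<close> into the interval of radius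
  \<open>C * l1_norm \<nu> f\<close>; the remaining \<open>n - n0\<close> steps contract it. The
  shift by \<open>n0\<close> goes into the constant as \<open>1 / \<rho> ^ n0\<close>.\<close>

lemma ultrabounded_imp_ergodic:
  assumes "ultrabounded"
  shows "geom_unif_ergodic Q \<nu>"
proof -
  obtain n0 C where C: "0 < C" "\<And>f x. f \<in> l1 \<nu> \<Longrightarrow> \<bar>Q n0 f x\<bar> \<le> C * l1_norm \<nu> f"
    using ultraboundedE[OF assms] by metis
  obtain N \<theta> where N: "0 < N" and \<theta>: "0 < \<theta>" "\<theta> < 1"
    and contr: "\<And>f l u n x. (\<And>x. l \<le> f x) \<Longrightarrow> (\<And>x. f x \<le> u) \<Longrightarrow>
       \<bar>Q n f x - mean \<nu> f\<bar> \<le> \<theta> ^ (n div N) * (u - l)"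
    using ultrabounded_contraction[OF assms] by metis
  obtain \<rho> where \<rho>: "0 < \<rho>" "\<rho> < 1" and \<theta>_le: "\<And>n. \<theta> ^ (n div N) \<le> \<rho> ^ n / \<theta>"
    using geometric_floor_bound[OF \<theta> N] by metis
  have bound: "\<bar>Q n f x - mean \<nu> f\<bar> \<le> 2 * C / (\<theta> * \<rho> ^ n0) * \<rho> ^ n * l1_norm \<nu> f"
    if f: "f \<in> l1 \<nu>" and n: "n0 \<le> n" for f n x
  proof -
    have mean: "mean \<nu> f = mean \<nu> (Q n0 f)"
      by (simp only: mean_def Q_invariant[OF f])
    have split: "Q n f = Q (n - n0) (Q n0 f)"
      using Q_split[of "n - n0" n0 f] n by simp
    have b: "- (C * l1_norm \<nu> f) \<le> Q n0 f x" "Q n0 f x \<le> C * l1_norm \<nu> f" for x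
      using C(2)[OF f, of x] by auto
    have "\<bar>Q n f x - mean \<nu> f\<bar> \<le> \<theta> ^ ((n - n0) div N) * (2 * C * l1_norm \<nu> f)"
      using contr[of "- (C * l1_norm \<nu> f)" "Q n0 f" "C * l1_norm \<nu> f" "n - n0" x, OF b]
      by (simp add: split mean)
    also have "\<dots> \<le> \<rho> ^ (n - n0) / \<theta> * (2 * C * l1_norm \<nu> f)"
      using \<theta>_le C l1_norm_nonneg[of \<nu> f, OF \<nu>_pos] by (intro mult_right_mono) auto
    also have "\<rho> ^ (n - n0) = \<rho> ^ n / \<rho> ^ n0"
      using \<rho> n by (simp add: power_diff)
    finally show ?thesis
      by (simp add: field_simps)
  qed
  then have "\<forall>\<^sub>F n in sequentially. \<forall>f\<in>l1 \<nu>. \<forall>x.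
      \<bar>Q n f x - mean \<nu> f\<bar> \<le> 2 * C / (\<theta> * \<rho> ^ n0) * \<rho> ^ n * l1_norm \<nu> f"
    unfolding eventually_sequentially by blast
  moreover have "0 < 2 * C / (\<theta> * \<rho> ^ n0)"
    using C \<theta> \<rho> by simp
  ultimately show ?thesis
    unfolding geom_unif_ergodic_def using \<rho> by blast
qed

text \<open>One sufficiently large \<open>n\<close> suffices, since the mean is itself bounded by
  the norm divided by \<open>total\<close>.\<close>

lemma ergodic_imp_ultrabounded:
  assumes "geom_unif_ergodic Q \<nu>"
  shows "ultrabounded"
proof -
  obtain C \<rho> where "\<forall>\<^sub>F n in sequentially. \<forall>f\<in>l1 \<nu>. \<forall>x.
      \<bar>Q n f x - mean \<nu> f\<bar> \<le> C * \<rho> ^ n * l1_norm \<nu> f"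
    using assms unfolding geom_unif_ergodic_def by blast
  then obtain n where n: "1 \<le> n"
    and *: "\<And>f x. f \<in> l1 \<nu> \<Longrightarrow> \<bar>Q n f x - mean \<nu> f\<bar> \<le> C * \<rho> ^ n * l1_norm \<nu> f"
    unfolding eventually_sequentially by (metis linorder_linear)
  have "\<bar>Q n f x\<bar> \<le> (C * \<rho> ^ n + 1 / total) * l1_norm \<nu> f" if "f \<in> l1 \<nu>" for f x
    using *[OF that, of x] mean_le[of f] by (simp add: distrib_right)
  then show ?thesis
    unfolding ultrabounded_def bounded_l1_linf_def using n by blast
qed

text \<open>Passing to the dual transposes the density. Concretely, \<open>Q n\<close> of the
  indicator of \<open>y\<close> is at most \<open>C * \<nu> y\<close>; pairing it with
  \<open>f\<close> evaluates the dual iterate at \<open>y\<close>, and \<open>\<nu> y\<close>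
  cancels.\<close>

lemma ultrabounded_imp_dual_ultrabounded:
  assumes "ultrabounded"
  shows "dual_markov_pair.ultrabounded qh \<nu>"
proof -
  interpret d: dual_markov_pair qh q \<nu>
    by (rule dual)
  obtain n C where n: "1 \<le> n" and C: "0 < C" "\<And>f x. f \<in> l1 \<nu> \<Longrightarrow> \<bar>Q n f x\<bar> \<le> C * l1_norm \<nu> f"
    using ultraboundedE[OF assms] by metis
  have "\<bar>d.Q n f y\<bar> \<le> C * l1_norm \<nu> f" if f: "f \<in> l1 \<nu>" for f y
  proof -
    let ?e = "indicator {y} :: 'a \<Rightarrow> real"
    have e: "?e \<in> l1 \<nu>"
      by (rule l1_bounded[of _ 1]) (simp add: indicator_def)
    have single: "(\<Sum>\<^sub>\<infinity>x. g x * ?e x * \<nu> x) = g y * \<nu> y" for g :: "'a \<Rightarrow> real"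
      using infsum_cong_neutral[of UNIV "{y}" "\<lambda>x. g x * ?e x * \<nu> x" "\<lambda>x. g x * \<nu> x"]
      by simp
    have norm_e: "l1_norm \<nu> ?e = \<nu> y"
      using single[of "\<lambda>_. 1"] by (simp add: l1_norm_def)
    have Qe: "\<bar>Q n ?e x\<bar> \<le> C * \<nu> y" for x
      using C(2)[OF e, of x] norm_e by simp
    have "\<bar>d.Q n f y\<bar> * \<nu> y = \<bar>\<Sum>\<^sub>\<infinity>x. d.Q n f x * ?e x * \<nu> x\<bar>"
      using \<nu>_pos[of y] by (simp add: single abs_mult)
    also have "\<dots> = \<bar>\<Sum>\<^sub>\<infinity>x. f x * Q n ?e x * \<nu> x\<bar>"
      using d.Q_pairing[OF f, of ?e 1 n] by (simp add: indicator_def)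
    also have "\<dots> \<le> l1_norm \<nu> (\<lambda>x. f x * Q n ?e x)"
      by (rule abs_infsum_le_l1_norm[OF \<nu>_pos])
    also have "\<dots> \<le> (\<Sum>\<^sub>\<infinity>x. C * \<nu> y * (norm (f x) * \<nu> x))"
      unfolding l1_norm_def
    proof (rule infsum_mono)
      show s: "(\<lambda>x. C * \<nu> y * (norm (f x) * \<nu> x)) summable_on UNIV"
        using f unfolding l1_def by (intro summable_on_cmult_right) auto
      show le: "norm (f x * Q n ?e x) * \<nu> x \<le> C * \<nu> y * (norm (f x) * \<nu> x)" for x
        using mult_right_mono[OF Qe, of "\<bar>f x\<bar> * \<nu> x" x] \<nu>_pos[of x]
        by (simp add: abs_mult mult_ac)
      show "(\<lambda>x. norm (f x * Q n ?e x) * \<nu> x) summable_on UNIV"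
        by (rule summable_on_comparison_test[OF s le]) (simp add: less_imp_le[OF \<nu>_pos])
    qed
    also have "\<dots> = C * l1_norm \<nu> f * \<nu> y"
      by (simp add: infsum_cmult_right' l1_norm_def)
    finally show ?thesis
      using \<nu>_pos[of y] by simp
  qed
  then show ?thesis
    unfolding d.ultrabounded_def bounded_l1_linf_def using n by blast
qed

section \<open>Quasi-ergodicity as convergence of ratios\<close>

lemma ergodic_eventually:
  assumes "geom_unif_ergodic Q \<nu>" "0 < \<epsilon>"
  shows "\<forall>\<^sub>F n in sequentially. \<forall>f\<in>l1 \<nu>. \<forall>x. \<bar>Q n f x - mean \<nu> f\<bar> \<le> \<epsilon> * l1_norm \<nu> f"
proof -
  obtain C \<rho> where \<rho>: "0 < \<rho>" "\<rho> < 1"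
    and erg: "\<forall>\<^sub>F n in sequentially. \<forall>f\<in>l1 \<nu>. \<forall>x.
      \<bar>Q n f x - mean \<nu> f\<bar> \<le> C * \<rho> ^ n * l1_norm \<nu> f"
    using assms(1) unfolding geom_unif_ergodic_def by blast
  have "(\<lambda>n. C * \<rho> ^ n) \<longlonglongrightarrow> 0"
    using \<rho> by (intro tendsto_mult_right_zero LIMSEQ_realpow_zero) auto
  then have "\<forall>\<^sub>F n in sequentially. C * \<rho> ^ n < \<epsilon>"
    using assms(2) by (rule order_tendstoD)
  with erg show ?thesis
  proof eventually_elim
    case (elim n)
    show ?case
    proof (intro ballI allI)
      fix f :: "'a \<Rightarrow> real" and x assume f: "f \<in> l1 \<nu>"
      have "C * \<rho> ^ n * l1_norm \<nu> f \<le> \<epsilon> * l1_norm \<nu> f"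
        using elim(2) l1_norm_nonneg[of \<nu> f, OF \<nu>_pos] by (intro mult_right_mono) auto
      with elim(1) f show "\<bar>Q n f x - mean \<nu> f\<bar> \<le> \<epsilon> * l1_norm \<nu> f"
        using order_trans by blast
    qed
  qed
qed

text \<open>This is condition (c) after the substitution \<open>g = f / \<phi>\<close>, with
  \<open>h = 1 / \<phi>\<close>; the normalization of the quasi-stationary measure appears as the
  integral of \<open>h\<close>.\<close>

definition quasi_ergodic :: "('a \<Rightarrow> real) \<Rightarrow> bool" where
  "quasi_ergodic h \<longleftrightarrow> (\<exists>C>0. \<exists>\<rho>. 0 < \<rho> \<and> \<rho> < 1 \<and> (\<forall>\<^sub>F n in sequentially. \<forall>g\<in>l1 \<nu>. \<forall>x.
     \<bar>Q n g x / Q n h x - (\<Sum>\<^sub>\<infinity>y. g y * \<nu> y) / (\<Sum>\<^sub>\<infinity>y. h y * \<nu> y)\<bar> \<le> C * \<rho> ^ n * l1_norm \<nu> g))"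

context
  fixes h :: "'a \<Rightarrow> real"
  assumes h_pos: "\<And>x. 0 < h x"
begin

lemma integral_pos:
  assumes "h \<in> l1 \<nu>"
  shows "0 < (\<Sum>\<^sub>\<infinity>x. h x * \<nu> x)"
proof -
  have "h undefined * \<nu> undefined \<le> (\<Sum>\<^sub>\<infinity>x. h x * \<nu> x)"
    using finite_sum_le_infsum[of "\<lambda>x. h x * \<nu> x" UNIV "{undefined}"] assms l1_iff h_pos \<nu>_pos
    by (simp add: less_imp_le)
  then show ?thesis
    using \<nu>_pos[of undefined] h_pos[of undefined] by (smt (verit) mult_pos_pos)
qed

text \<open>Here \<open>h\<close> has summable rows but need not be in \<open>l1 \<nu>\<close>, so
  monotonicity of \<open>Q\<close> does not apply to it. The induction iterates only the integrable
  \<open>g\<close> and compares with \<open>h\<close> one step at a time.\<close>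

lemma Q_le_superharmonic:
  assumes super: "\<And>x. (\<lambda>y. q x y * h y) summable_on UNIV" "\<And>x. kernel_op q h x \<le> K * h x"
    and g: "g \<in> l1 \<nu>" "\<And>x. g x \<le> h x"
  shows "Q n g x \<le> K ^ n * h x"
proof (induction n arbitrary: x)
  case (Suc n)
  have K: "0 \<le> K"
  proof -
    have "0 \<le> kernel_op q h x"
      unfolding kernel_op_def using q_pos h_pos by (intro infsum_nonneg) (simp add: less_imp_le)
    then show ?thesis
      using super(2)[of x] h_pos[of x] by (smt (verit) mult_neg_pos)
  qed
  have "Q (Suc n) g x \<le> (\<Sum>\<^sub>\<infinity>y. K ^ n * (q x y * h y))"
    unfolding funpow.simps comp_def kernel_op_def[of q "Q n g"]
  proof (rule infsum_mono[OF q_summable[OF Q_l1[OF g(1)]] summable_on_cmult_right[OF super(1)]])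
    show "q x y * Q n g y \<le> K ^ n * (q x y * h y)" for y
      using mult_left_mono[OF Suc.IH, of "q x y" y] q_pos[of x y] by (simp add: mult_ac)
  qed
  also have "\<dots> \<le> K ^ n * (K * h x)"
    using super(2)[of x] K unfolding infsum_cmult_right' kernel_op_def by (intro mult_left_mono) auto
  finally show ?case
    by (simp add: mult_ac)
qed (use g in simp)

text \<open>
  Ergodicity yields \<open>Q n g \<ge> c \<nu>(g)\<close> for \<open>g \<ge> 0\<close>; applied to truncations of \<open>h\<close> this bounds
  \<open>\<nu>(h)\<close> by a multiple of a value of \<open>h\<close>.
\<close>

lemma ergodic_imp_superharmonic_l1:
  assumes erg: "geom_unif_ergodic Q \<nu>"
    and super: "\<And>x. (\<lambda>y. q x y * h y) summable_on UNIV" "\<And>x. kernel_op q h x \<le> K * h x"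
  shows "h \<in> l1 \<nu>"
proof -
  \<comment> \<open>With this tolerance the error is half the mean of any nonnegative
    \<open>g\<close>, so \<open>Q n g\<close> is at least
    \<open>l1_norm \<nu> g / (2 * total)\<close>.\<close>
  have "0 < 1 / (2 * total)"
    using total_pos by simp
  from ergodic_eventually[OF erg this] obtain n
    where n: "\<And>f x. f \<in> l1 \<nu> \<Longrightarrow> \<bar>Q n f x - mean \<nu> f\<bar> \<le> 1 / (2 * total) * l1_norm \<nu> f"
    unfolding eventually_sequentially by blast
  define x0 :: 'a where "x0 = undefined"
  have "(\<Sum>x\<in>F. h x * \<nu> x) \<le> 2 * total * (K ^ n * h x0)" if F: "finite F" for F
  proof -
    define g where "g = (\<lambda>x. h x * indicator F x)"
    have sum_g: "(\<Sum>\<^sub>\<infinity>x. g x * \<nu> x) = (\<Sum>x\<in>F. h x * \<nu> x)"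
      using infsum_cong_neutral[of UNIV F "\<lambda>x. g x * \<nu> x" "\<lambda>x. h x * \<nu> x"] F
      by (simp add: g_def)
    have g_nonneg: "0 \<le> g x" for x
      using h_pos[of x] by (simp add: g_def)
    have "(\<lambda>x. g x * \<nu> x) summable_on UNIV"
      using summable_on_cong_neutral[of UNIV F "\<lambda>x. g x * \<nu> x" "\<lambda>x. h x * \<nu> x"] F
      by (simp add: g_def)
    then have g: "g \<in> l1 \<nu>"
      by (simp add: l1_iff)
    have norm_g: "l1_norm \<nu> g = (\<Sum>x\<in>F. h x * \<nu> x)"
      using sum_g g_nonneg by (simp add: l1_norm_def)
    have "mean \<nu> g - 1 / (2 * total) * l1_norm \<nu> g \<le> Q n g x0"
      using n[OF g, of x0] by linarith
    also have "\<dots> \<le> K ^ n * h x0"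
      by (rule Q_le_superharmonic[OF super g]) (use h_pos in \<open>simp add: g_def indicator_def less_imp_le\<close>)
    finally show ?thesis
      using total_pos unfolding mean_def sum_g norm_g by (simp add: field_simps)
  qed
  then show ?thesis
    unfolding l1_iff using h_pos \<nu>_pos
    by (intro nonneg_bdd_above_summable_on bdd_aboveI2) (auto simp: less_imp_le)
qed

text \<open>Numerator and denominator converge uniformly to their means, and the denominator is
  eventually at least half of its positive limit \<open>M\<close>.\<close>

lemma ergodic_imp_quasi_ergodic:
  assumes erg: "geom_unif_ergodic Q \<nu>" and h: "h \<in> l1 \<nu>"
  shows "quasi_ergodic h"
proof -
  define M where "M = mean \<nu> h"
  define H where "H = l1_norm \<nu> h"
  have M: "0 < M"
    using integral_pos[OF h] total_pos by (simp add: M_def mean_def)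
  have H: "0 < H"
    using integral_pos[OF h] abs_infsum_le_l1_norm[of \<nu> h, OF \<nu>_pos] unfolding H_def by linarith
  obtain C \<rho> where C: "0 < C" and \<rho>: "0 < \<rho>" "\<rho> < 1"
    and conv: "\<forall>\<^sub>F n in sequentially. \<forall>f\<in>l1 \<nu>. \<forall>x.
      \<bar>Q n f x - mean \<nu> f\<bar> \<le> C * \<rho> ^ n * l1_norm \<nu> f"
    using erg unfolding geom_unif_ergodic_def by blast
  have "0 < M / (2 * H)"
    using M H by simp
  note half = ergodic_eventually[OF erg this]
  \<comment> \<open>The first summand comes from the error of the numerator over
    \<open>M / 2\<close>, the second from the mean of \<open>g\<close> times the error of the
    denominator over \<open>M / 2 * M\<close>.\<close>
  define D where "D = C * 2 / M + C * H * 2 / (M * M * total)"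
  have "\<forall>\<^sub>F n in sequentially. \<forall>g\<in>l1 \<nu>. \<forall>x.
     \<bar>Q n g x / Q n h x - (\<Sum>\<^sub>\<infinity>y. g y * \<nu> y) / (\<Sum>\<^sub>\<infinity>y. h y * \<nu> y)\<bar> \<le> D * \<rho> ^ n * l1_norm \<nu> g"
    using conv half
  proof eventually_elim
    case (elim n)
    show ?case
    proof (intro ballI allI)
      fix g :: "'a \<Rightarrow> real" and x assume g: "g \<in> l1 \<nu>"
      define A where "A = Q n g x"
      define B where "B = Q n h x"
      define a where "a = mean \<nu> g"
      define G where "G = l1_norm \<nu> g"
      have A: "\<bar>A - a\<bar> \<le> C * \<rho> ^ n * G" and BM: "\<bar>B - M\<bar> \<le> C * \<rho> ^ n * H"
        using elim(1) g h by (auto simp: A_def B_def a_def G_def M_def H_def)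
      have "\<bar>B - M\<bar> \<le> M / (2 * H) * H"
        using elim(2) h by (auto simp: B_def M_def H_def)
      then have "\<bar>B - M\<bar> \<le> M / 2"
        using H by simp
      then have B: "M / 2 \<le> B"
        by linarith
      have a: "\<bar>a\<bar> \<le> G / total"
        unfolding a_def G_def by (rule mean_le)
      have G: "0 \<le> G"
        unfolding G_def by (rule l1_norm_nonneg[OF \<nu>_pos])
      have 1: "\<bar>A - a\<bar> / B \<le> C * \<rho> ^ n * G / (M / 2)"
        using A B M by (intro frac_le) auto
      have "\<bar>a\<bar> * \<bar>B - M\<bar> / (B * M) \<le> (G / total) * (C * \<rho> ^ n * H) / (M / 2 * M)"
        using a BM B M G total_pos H C \<rho> by (intro frac_le mult_mono) auto
      moreover have "A / B - a / M = (A - a) / B - a * (B - M) / (B * M)"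
        using B M by (simp add: field_simps)
      then have "\<bar>A / B - a / M\<bar> \<le> \<bar>A - a\<bar> / B + \<bar>a\<bar> * \<bar>B - M\<bar> / (B * M)"
        using abs_triangle_ineq4[of "(A - a) / B" "a * (B - M) / (B * M)"] B M by (simp add: abs_mult)
      ultimately have "\<bar>A / B - a / M\<bar>
          \<le> C * \<rho> ^ n * G / (M / 2) + (G / total) * (C * \<rho> ^ n * H) / (M / 2 * M)"
        using 1 by linarith
      also have "\<dots> = D * \<rho> ^ n * G"
        using M total_pos by (simp add: D_def field_simps)
      finally have "\<bar>A / B - a / M\<bar> \<le> D * \<rho> ^ n * G" .
      moreover have "a / M = (\<Sum>\<^sub>\<infinity>y. g y * \<nu> y) / (\<Sum>\<^sub>\<infinity>y. h y * \<nu> y)"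
        using total_pos by (simp add: a_def M_def mean_def)
      ultimately show "\<bar>Q n g x / Q n h x - (\<Sum>\<^sub>\<infinity>y. g y * \<nu> y) / (\<Sum>\<^sub>\<infinity>y. h y * \<nu> y)\<bar>
          \<le> D * \<rho> ^ n * l1_norm \<nu> g"
        by (simp add: A_def B_def G_def)
    qed
  qed
  moreover have "0 < D"
    using C M H total_pos unfolding D_def by (intro add_pos_pos) auto
  ultimately show ?thesis
    unfolding quasi_ergodic_def using \<rho> by blast
qed

text \<open>
  Testing with \<open>g = 1\<close> bounds \<open>Q n h\<close> from above, so the denominator can be removed.
\<close>

lemma quasi_ergodic_imp_ultrabounded:
  assumes quasi: "quasi_ergodic h" and h: "h \<in> l1 \<nu>"
  shows "ultrabounded"
proof -
  define H where "H = (\<Sum>\<^sub>\<infinity>y. h y * \<nu> y)"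
  have H: "0 < H"
    unfolding H_def by (rule integral_pos[OF h])
  obtain C \<rho> where \<rho>: "0 < \<rho>" "\<rho> < 1"
    and conv: "\<forall>\<^sub>F n in sequentially. \<forall>g\<in>l1 \<nu>. \<forall>x.
      \<bar>Q n g x / Q n h x - (\<Sum>\<^sub>\<infinity>y. g y * \<nu> y) / H\<bar> \<le> C * \<rho> ^ n * l1_norm \<nu> g"
    using quasi unfolding quasi_ergodic_def H_def by blast
  have "(\<lambda>n. C * \<rho> ^ n) \<longlonglongrightarrow> 0"
    using \<rho> by (intro tendsto_mult_right_zero LIMSEQ_realpow_zero) auto
  \<comment> \<open>For \<open>g = 1\<close> this threshold makes the error half of the limit
    \<open>total / H\<close>.\<close>
  then have "\<forall>\<^sub>F n in sequentially. C * \<rho> ^ n < 1 / (2 * H)"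
    using H by (intro order_tendstoD) auto
  from eventually_happens[OF eventually_conj[OF conv eventually_conj[OF this eventually_ge_at_top[of 1]]]]
  obtain n where n: "1 \<le> n" "C * \<rho> ^ n < 1 / (2 * H)"
    and ratio: "\<And>g x. g \<in> l1 \<nu> \<Longrightarrow>
      \<bar>Q n g x / Q n h x - (\<Sum>\<^sub>\<infinity>y. g y * \<nu> y) / H\<bar> \<le> C * \<rho> ^ n * l1_norm \<nu> g"
    by auto
  have ratio': "\<bar>Q n g x / Q n h x - (\<Sum>\<^sub>\<infinity>y. g y * \<nu> y) / H\<bar> \<le> l1_norm \<nu> g / (2 * H)"
    if "g \<in> l1 \<nu>" for g x
    using ratio[OF that, of x] mult_right_mono[OF less_imp_le[OF n(2)], of "l1_norm \<nu> g"]
      l1_norm_nonneg[of \<nu> g, OF \<nu>_pos] by simp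
  have Qh: "0 < Q n h x" "Q n h x \<le> 2 * H / total" for x
  proof -
    have "\<bar>1 / Q n h x - total / H\<bar> \<le> total / (2 * H)"
      using ratio'[OF l1_bounded[of "\<lambda>_. 1" 1], of x] by (simp add: Q_const l1_norm_def)
    moreover have "total / H = 2 * (total / (2 * H))"
      by simp
    ultimately have lower: "total / (2 * H) \<le> 1 / Q n h x"
      by linarith
    moreover have "0 < total / (2 * H)"
      using total_pos H by simp
    \<comment> \<open>The sign is read off from the reciprocal; \<open>1 / 0 = 0\<close> excludes a
      zero denominator.\<close>
    ultimately show pos: "0 < Q n h x"
      by (smt (verit) divide_nonneg_nonpos)
    show "Q n h x \<le> 2 * H / total"
      using lower pos H total_pos by (simp add: field_simps)
  qed
  have "\<bar>Q n g x\<bar> \<le> 3 / total * l1_norm \<nu> g" if g: "g \<in> l1 \<nu>" for g x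
  proof -
    have "\<bar>(\<Sum>\<^sub>\<infinity>y. g y * \<nu> y) / H\<bar> \<le> l1_norm \<nu> g / H"
      using abs_infsum_le_l1_norm[of \<nu> g, OF \<nu>_pos] H by (simp add: divide_right_mono)
    moreover have "l1_norm \<nu> g / H = 2 * (l1_norm \<nu> g / (2 * H))"
      by simp
    ultimately have "\<bar>Q n g x / Q n h x\<bar> \<le> 3 * (l1_norm \<nu> g / (2 * H))"
      using ratio'[OF g, of x] by linarith
    then have "\<bar>Q n g x\<bar> \<le> 3 * (l1_norm \<nu> g / (2 * H)) * Q n h x"
      using Qh(1)[of x] by (simp add: pos_divide_le_eq)
    also have "\<dots> \<le> 3 * (l1_norm \<nu> g / (2 * H)) * (2 * H / total)"
      using Qh(2)[of x] H l1_norm_nonneg[of \<nu> g, OF \<nu>_pos] by (intro mult_left_mono) auto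
    finally show ?thesis
      using H by simp
  qed
  then show ?thesis
    unfolding ultrabounded_def bounded_l1_linf_def using n(1) by blast
qed

end

end

section \<open>Doob transform of an adjoint pair of kernels\<close>

text \<open>The eigenvalue equations use \<open>has_sum\<close>, so that they assert convergence.
  The common bound \<open>K\<close> on the row sums makes \<open>1 / \<phi>\<close> and
  \<open>1 / \<phi>h\<close> superharmonic up to a factor for the transformed kernels.\<close>

locale doob_pair =
  fixes k kh :: "'a \<Rightarrow> 'a \<Rightarrow> real" and \<mu> \<phi> \<phi>h :: "'a \<Rightarrow> real" and lam K :: real
  assumes k_pos: "0 < k x y"
    and k_summable: "k x summable_on UNIV" and k_le: "(\<Sum>\<^sub>\<infinity>y. k x y) \<le> K"
    and kh_summable: "kh x summable_on UNIV" and kh_le: "(\<Sum>\<^sub>\<infinity>y. kh x y) \<le> K"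
    and \<mu>_pos: "0 < \<mu> x" and \<phi>_pos: "0 < \<phi> x" and \<phi>h_pos: "0 < \<phi>h x"
    and eigen: "((\<lambda>y. k x y * \<phi> y) has_sum lam * \<phi> x) UNIV"
    and eigen_h: "((\<lambda>y. kh x y * \<phi>h y) has_sum lam * \<phi>h x) UNIV"
    and k_balance: "\<mu> x * k x y = \<mu> y * kh y x"
    and lam_pos: "0 < lam"
    and nu_summable: "nu \<mu> \<phi> \<phi>h summable_on UNIV"
begin

lemma kh_pos: "0 < kh x y"
  by (metis k_pos \<mu>_pos k_balance mult_pos_pos zero_less_mult_pos)

lemma nu_commute: "nu \<mu> \<phi>h \<phi> = nu \<mu> \<phi> \<phi>h"
  by (simp add: nu_def fun_eq_iff)

lemma dual_pair: "doob_pair kh k \<mu> \<phi>h \<phi> lam K"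
  using k_summable k_le kh_summable kh_le \<mu>_pos \<phi>_pos \<phi>h_pos eigen eigen_h lam_pos nu_summable
    k_balance[symmetric] kh_pos nu_commute
  by unfold_locales simp_all

definition q :: "'a \<Rightarrow> 'a \<Rightarrow> real" where
  "q x y = k x y * \<phi> y / (lam * \<phi> x)"

definition qh :: "'a \<Rightarrow> 'a \<Rightarrow> real" where
  "qh x y = kh x y * \<phi>h y / (lam * \<phi>h x)"

text \<open>The eigenvalue equations give unit row sums. Both sides of the balance equation reduce
  to \<open>\<mu> x * k x y * \<phi>h x * \<phi> y / lam\<close>.\<close>

sublocale dual_markov_pair q qh "nu \<mu> \<phi> \<phi>h"
proof
  fix x y
  show "0 < q x y"
    using k_pos \<phi>_pos lam_pos by (simp add: q_def)
  show "(q x has_sum 1) UNIV"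
    using has_sum_cmult_left[OF eigen[of x], of "1 / (lam * \<phi> x)"] \<phi>_pos[of x] lam_pos
    by (simp add: q_def[abs_def])
  show "(qh x has_sum 1) UNIV"
    using has_sum_cmult_left[OF eigen_h[of x], of "1 / (lam * \<phi>h x)"] \<phi>h_pos[of x] lam_pos
    by (simp add: qh_def[abs_def])
  show "0 < nu \<mu> \<phi> \<phi>h x"
    using \<mu>_pos \<phi>_pos \<phi>h_pos by (simp add: nu_def)
  show "nu \<mu> \<phi> \<phi>h summable_on UNIV"
    by (rule nu_summable)
  show "nu \<mu> \<phi> \<phi>h x * q x y = nu \<mu> \<phi> \<phi>h y * qh y x"
    using k_balance[of x y] \<phi>_pos[of x] \<phi>h_pos[of y] lam_pos by (simp add: nu_def q_def qh_def)
qed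

text \<open>\<open>k\<close> is \<open>lam * q\<close> conjugated by \<phi>, so the intermediate
  factors of \<phi> cancel under iteration.\<close>

lemma kernel_power: "(kernel_op k ^^ n) f x = lam ^ n * \<phi> x * Q n (\<lambda>y. f y / \<phi> y) x"
proof (induction n arbitrary: x)
  case 0
  then show ?case using \<phi>_pos[of x] by simp
next
  case (Suc n)
  have "(kernel_op k ^^ n) f = (\<lambda>x. lam ^ n * \<phi> x * Q n (\<lambda>y. f y / \<phi> y) x)"
    using Suc.IH by blast
  then have "(kernel_op k ^^ Suc n) f x
      = (\<Sum>\<^sub>\<infinity>y. k x y * (lam ^ n * \<phi> y * Q n (\<lambda>y. f y / \<phi> y) y))"
    by (simp add: kernel_op_def[of k])
  also have "\<dots> = (\<Sum>\<^sub>\<infinity>y. lam ^ Suc n * \<phi> x * (q x y * Q n (\<lambda>y. f y / \<phi> y) y))"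
    using \<phi>_pos[of x] lam_pos by (simp add: q_def mult_ac)
  also have "\<dots> = lam ^ Suc n * \<phi> x * Q (Suc n) (\<lambda>y. f y / \<phi> y) x"
    by (simp add: infsum_cmult_right' kernel_op_def[of q])
  finally show ?case .
qed

lemma intrinsic_eq: "intrinsic (kernel_op k) lam \<phi> = Q"
proof (intro ext)
  fix n f x
  have "(\<lambda>y. f y * \<phi> y / \<phi> y) = f"
    using less_imp_neq[OF \<phi>_pos] by (simp add: fun_eq_iff eq_commute[of 0])
  then show "intrinsic (kernel_op k) lam \<phi> n f x = Q n f x"
    using \<phi>_pos[of x] lam_pos by (simp add: intrinsic_def kernel_power)
qed

lemma aIUC_iff_ultrabounded: "aIUC (kernel_op k) lam \<phi> (nu \<mu> \<phi> \<phi>h) \<longleftrightarrow> ultrabounded"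
  by (simp add: aIUC_def ultrabounded_def intrinsic_eq)

lemma aIUC_imp_dual:
  assumes "aIUC (kernel_op k) lam \<phi> (nu \<mu> \<phi> \<phi>h)"
  shows "aIUC (kernel_op kh) lam \<phi>h (nu \<mu> \<phi> \<phi>h)"
proof -
  interpret d: doob_pair kh k \<mu> \<phi>h \<phi> lam K
    by (rule dual_pair)
  have "d.q = qh"
    by (simp add: fun_eq_iff d.q_def qh_def)
  then show ?thesis
    using assms ultrabounded_imp_dual_ultrabounded aIUC_iff_ultrabounded d.aIUC_iff_ultrabounded
    by (simp add: nu_commute)
qed

lemma aIUC_iff_ergodic:
  "aIUC (kernel_op k) lam \<phi> (nu \<mu> \<phi> \<phi>h)
    \<longleftrightarrow> geom_unif_ergodic (intrinsic (kernel_op k) lam \<phi>) (nu \<mu> \<phi> \<phi>h)"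
  using aIUC_iff_ultrabounded intrinsic_eq ultrabounded_imp_ergodic ergodic_imp_ultrabounded by auto

lemma kernel_power_one_pos: "0 < (kernel_op k ^^ n) (\<lambda>_. 1) x"
proof -
  \<comment> \<open>The upper bound is carried along because it makes the next sum converge; its
    diagonal term then gives positivity.\<close>
  have "(\<forall>x. 0 < (kernel_op k ^^ n) (\<lambda>_. 1) x) \<and> (\<exists>B. \<forall>x. (kernel_op k ^^ n) (\<lambda>_. 1) x \<le> B)"
  proof (induction n)
    case (Suc n)
    define g where "g = (kernel_op k ^^ n) (\<lambda>_. 1)"
    obtain B where g: "\<And>x. 0 < g x" "\<And>x. g x \<le> B"
      using Suc unfolding g_def by blast
    have B: "0 \<le> B"
      using g[of undefined] by linarith
    have le: "k x y * g y \<le> B * k x y" for x y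
      using mult_left_mono[OF g(2)[of y], of "k x y"] k_pos[of x y] by (simp add: mult.commute)
    have s: "(\<lambda>y. k x y * g y) summable_on UNIV" for x
      by (rule summable_on_comparison_test[OF summable_on_cmult_right[OF k_summable] le])
        (use g k_pos in \<open>simp add: less_imp_le\<close>)
    have "0 < kernel_op k g x" for x
    proof -
      have "k x x * g x \<le> kernel_op k g x"
        using finite_sum_le_infsum[OF s, of "{x}" x] g k_pos by (simp add: kernel_op_def less_imp_le)
      then show ?thesis
        using mult_pos_pos[OF k_pos[of x x] g(1)[of x]] by linarith
    qed
    moreover have "kernel_op k g x \<le> B * K" for x
    proof -
      have "kernel_op k g x \<le> B * (\<Sum>\<^sub>\<infinity>y. k x y)"
        unfolding kernel_op_def infsum_cmult_right'[symmetric]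
        by (rule infsum_mono[OF s summable_on_cmult_right[OF k_summable] le])
      also have "\<dots> \<le> B * K"
        using k_le B by (rule mult_left_mono)
      finally show ?thesis .
    qed
    ultimately show ?case
      by (auto simp: g_def)
  qed auto
  then show ?thesis by blast
qed

abbreviation h :: "'a \<Rightarrow> real" where
  "h \<equiv> \<lambda>x. 1 / \<phi> x"

lemma h_pos: "0 < h x"
  using \<phi>_pos by simp

text \<open>The factor \<open>\<phi> y\<close> cancels, which leaves the row sum of \<open>k\<close>
  over \<open>lam * \<phi> x\<close>.\<close>

lemma h_summable: "(\<lambda>y. q x y * h y) summable_on UNIV"
  and h_superharmonic: "kernel_op q h x \<le> K / lam * h x"
proof -
  have eq: "(\<lambda>y. q x y * h y) = (\<lambda>y. k x y * (1 / (lam * \<phi> x)))"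
    using \<phi>_pos by (simp add: q_def fun_eq_iff less_imp_neq[THEN not_sym])
  show "(\<lambda>y. q x y * h y) summable_on UNIV"
    unfolding eq by (rule summable_on_cmult_left[OF k_summable])
  show "kernel_op q h x \<le> K / lam * h x"
    using mult_right_mono[OF k_le[of x], of "1 / (lam * \<phi> x)"] \<phi>_pos[of x] lam_pos
    unfolding kernel_op_def eq infsum_cmult_left' by simp
qed

lemma ratio_eq:
  "(kernel_op k ^^ n) f x / (kernel_op k ^^ n) (\<lambda>_. 1) x = Q n (\<lambda>y. f y / \<phi> y) x / Q n h x"
  using \<phi>_pos[of x] lam_pos by (simp add: kernel_power)

text \<open>For \<open>f = 1\<close> this identifies the integral of \<open>h\<close> with the norm
  of \<open>\<phi>h\<close> in \<open>\<ell>\<^sup>1(\<mu>)\<close>.\<close>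

lemma nu_div: "f x / \<phi> x * nu \<mu> \<phi> \<phi>h x = f x * (\<phi>h x * \<mu> x)"
  using \<phi>_pos[of x] by (simp add: nu_def)

text \<open>
  If \<open>\<phi>h\<close> were not in \<open>\<ell>\<^sup>1(\<mu>)\<close>, then \<open>quasi_stat \<mu> \<phi>h\<close> would be the junk value \<open>0\<close>.
\<close>

lemma quasi_ergodic_imp_h_l1:
  assumes "geom_unif_quasi_ergodic (\<lambda>n. kernel_op k ^^ n) (quasi_stat \<mu> \<phi>h)"
  shows "h \<in> l1 (nu \<mu> \<phi> \<phi>h)"
proof (rule ccontr)
  assume "h \<notin> l1 (nu \<mu> \<phi> \<phi>h)"
  then have "\<not> (\<lambda>x. norm (\<phi>h x) * \<mu> x) summable_on UNIV"
    using nu_div[of "\<lambda>_. 1"] \<phi>h_pos by (simp add: l1_iff less_imp_le)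
  then have "l1_norm \<mu> \<phi>h = 0"
    unfolding l1_norm_def by (rule infsum_not_exists)
  then have m: "quasi_stat \<mu> \<phi>h = (\<lambda>_. 0)"
    by (simp add: quasi_stat_def fun_eq_iff)
  \<comment> \<open>Under the zero weight the constant 1 has norm and integral 0, whereas its
    quotient in (c) is 1.\<close>
  have one: "(\<lambda>_. 1 :: real) \<in> l1 (\<lambda>_. 0 :: real)" "l1_norm (\<lambda>_. 0) (\<lambda>_. 1 :: real) = 0"
    by (simp_all add: l1_def l1_norm_def)
  obtain C \<rho> where "\<forall>\<^sub>F n in sequentially. \<forall>f\<in>l1 (\<lambda>_. 0). \<forall>x.
      \<bar>(kernel_op k ^^ n) f x / (kernel_op k ^^ n) (\<lambda>_. 1) x - (\<Sum>\<^sub>\<infinity>y::'a. f y * 0)\<bar>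
        \<le> C * \<rho> ^ n * l1_norm (\<lambda>_. 0) f"
    using assms unfolding geom_unif_quasi_ergodic_def m by blast
  from eventually_happens[OF this] obtain n where "\<forall>f\<in>l1 (\<lambda>_. 0). \<forall>x.
      \<bar>(kernel_op k ^^ n) f x / (kernel_op k ^^ n) (\<lambda>_. 1) x - (\<Sum>\<^sub>\<infinity>y::'a. f y * 0)\<bar>
        \<le> C * \<rho> ^ n * l1_norm (\<lambda>_. 0) f"
    by auto
  from bspec[OF this one(1), THEN spec, of undefined]
  have "\<bar>(kernel_op k ^^ n) (\<lambda>_. 1) undefined / (kernel_op k ^^ n) (\<lambda>_. 1) undefined\<bar> \<le> (0::real)"
    by (simp only: one(2) mult_zero_right infsum_0_simp diff_zero)
  then show False
    using kernel_power_one_pos[of n undefined] by simp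
qed

text \<open>Division by \<phi> maps the two weighted spaces onto each other and scales norms by the
  fixed factor \<open>L\<close>, which is absorbed into the constant.\<close>

lemma quasi_ergodic_iff:
  assumes h: "h \<in> l1 (nu \<mu> \<phi> \<phi>h)"
  shows "geom_unif_quasi_ergodic (\<lambda>n. kernel_op k ^^ n) (quasi_stat \<mu> \<phi>h) \<longleftrightarrow> quasi_ergodic h"
proof -
  define L where "L = l1_norm \<mu> \<phi>h"
  have L_eq: "L = (\<Sum>\<^sub>\<infinity>y. h y * nu \<mu> \<phi> \<phi>h y)"
    using nu_div[of "\<lambda>_. 1"] \<phi>h_pos by (simp add: L_def l1_norm_def less_imp_le)
  have L: "0 < L"
    unfolding L_eq by (rule integral_pos[OF h_pos h])
  have m: "f x * quasi_stat \<mu> \<phi>h x = f x / \<phi> x * nu \<mu> \<phi> \<phi>h x * (1 / L)" for f x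
    using nu_div[of f x] by (simp add: quasi_stat_def L_def)
  have norm_m: "norm (f x) * quasi_stat \<mu> \<phi>h x = norm (f x / \<phi> x) * nu \<mu> \<phi> \<phi>h x * (1 / L)"
    for f :: "'a \<Rightarrow> real" and x
    using m[of "\<lambda>x. norm (f x)" x] \<phi>_pos[of x] by simp
  have l1_m: "f \<in> l1 (quasi_stat \<mu> \<phi>h) \<longleftrightarrow> (\<lambda>x. f x / \<phi> x) \<in> l1 (nu \<mu> \<phi> \<phi>h)"
    for f :: "'a \<Rightarrow> real"
    unfolding l1_def mem_Collect_eq norm_m using L by (subst summable_on_cmult_left') auto
  have norm: "l1_norm (quasi_stat \<mu> \<phi>h) f = l1_norm (nu \<mu> \<phi> \<phi>h) (\<lambda>x. f x / \<phi> x) / L"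
    for f :: "'a \<Rightarrow> real"
    unfolding l1_norm_def norm_m infsum_cmult_left' by simp
  have int: "(\<Sum>\<^sub>\<infinity>y. f y * quasi_stat \<mu> \<phi>h y)
      = (\<Sum>\<^sub>\<infinity>y. f y / \<phi> y * nu \<mu> \<phi> \<phi>h y) / (\<Sum>\<^sub>\<infinity>y. h y * nu \<mu> \<phi> \<phi>h y)" for f
  proof -
    have "(\<Sum>\<^sub>\<infinity>y. f y * quasi_stat \<mu> \<phi>h y) = (\<Sum>\<^sub>\<infinity>y. f y / \<phi> y * nu \<mu> \<phi> \<phi>h y) * (1 / L)"
      unfolding m[of f] by (rule infsum_cmult_left')
    then show ?thesis
      unfolding L_eq by (simp only: times_divide_eq_right mult_1_right)
  qed
  have reindex: "(\<forall>f\<in>l1 (quasi_stat \<mu> \<phi>h). R (\<lambda>x. f x / \<phi> x)) \<longleftrightarrow> (\<forall>g\<in>l1 (nu \<mu> \<phi> \<phi>h). R g)"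
    for R :: "('a \<Rightarrow> real) \<Rightarrow> bool"
  proof (intro iffI ballI)
    fix g :: "'a \<Rightarrow> real"
    assume R: "\<forall>f\<in>l1 (quasi_stat \<mu> \<phi>h). R (\<lambda>x. f x / \<phi> x)" and g: "g \<in> l1 (nu \<mu> \<phi> \<phi>h)"
    have "(\<lambda>x. g x * \<phi> x / \<phi> x) = g"
      using less_imp_neq[OF \<phi>_pos] by (simp add: fun_eq_iff eq_commute[of 0])
    then show "R g"
      using bspec[OF R, of "\<lambda>x. g x * \<phi> x"] g l1_m by simp
  qed (use l1_m in auto)
  have main: "geom_unif_quasi_ergodic (\<lambda>n. kernel_op k ^^ n) (quasi_stat \<mu> \<phi>h) \<longleftrightarrow>
    (\<exists>C>0. \<exists>\<rho>. 0 < \<rho> \<and> \<rho> < 1 \<and> (\<forall>\<^sub>F n in sequentially. \<forall>g\<in>l1 (nu \<mu> \<phi> \<phi>h). \<forall>x.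
      \<bar>Q n g x / Q n h x - (\<Sum>\<^sub>\<infinity>y. g y * nu \<mu> \<phi> \<phi>h y) / (\<Sum>\<^sub>\<infinity>y. h y * nu \<mu> \<phi> \<phi>h y)\<bar>
        \<le> C * \<rho> ^ n * (l1_norm (nu \<mu> \<phi> \<phi>h) g / L)))"
    unfolding geom_unif_quasi_ergodic_def ratio_eq int norm
    by (subst reindex) (rule refl)
  show ?thesis
    unfolding main quasi_ergodic_def
  proof (intro iffI; elim exE conjE)
    fix C \<rho> :: real
    assume C: "0 < C" and \<rho>: "0 < \<rho>" "\<rho> < 1"
      and *: "\<forall>\<^sub>F n in sequentially. \<forall>g\<in>l1 (nu \<mu> \<phi> \<phi>h). \<forall>x.
        \<bar>Q n g x / Q n h x - (\<Sum>\<^sub>\<infinity>y. g y * nu \<mu> \<phi> \<phi>h y) / (\<Sum>\<^sub>\<infinity>y. h y * nu \<mu> \<phi> \<phi>h y)\<bar>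
          \<le> C * \<rho> ^ n * (l1_norm (nu \<mu> \<phi> \<phi>h) g / L)"
    have eq: "C * \<rho> ^ n * (l1_norm (nu \<mu> \<phi> \<phi>h) g / L) = C / L * \<rho> ^ n * l1_norm (nu \<mu> \<phi> \<phi>h) g"
      for n and g :: "'a \<Rightarrow> real"
      by simp
    from *[unfolded eq] show "\<exists>C>0. \<exists>\<rho>. 0 < \<rho> \<and> \<rho> < 1 \<and> (\<forall>\<^sub>F n in sequentially. \<forall>g\<in>l1 (nu \<mu> \<phi> \<phi>h). \<forall>x.
        \<bar>Q n g x / Q n h x - (\<Sum>\<^sub>\<infinity>y. g y * nu \<mu> \<phi> \<phi>h y) / (\<Sum>\<^sub>\<infinity>y. h y * nu \<mu> \<phi> \<phi>h y)\<bar>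
          \<le> C * \<rho> ^ n * l1_norm (nu \<mu> \<phi> \<phi>h) g)"
      using divide_pos_pos[OF C L] \<rho> by blast
  next
    fix C \<rho> :: real
    assume C: "0 < C" and \<rho>: "0 < \<rho>" "\<rho> < 1"
      and *: "\<forall>\<^sub>F n in sequentially. \<forall>g\<in>l1 (nu \<mu> \<phi> \<phi>h). \<forall>x.
        \<bar>Q n g x / Q n h x - (\<Sum>\<^sub>\<infinity>y. g y * nu \<mu> \<phi> \<phi>h y) / (\<Sum>\<^sub>\<infinity>y. h y * nu \<mu> \<phi> \<phi>h y)\<bar>
          \<le> C * \<rho> ^ n * l1_norm (nu \<mu> \<phi> \<phi>h) g"
    have eq: "C * \<rho> ^ n * l1_norm (nu \<mu> \<phi> \<phi>h) g = C * L * \<rho> ^ n * (l1_norm (nu \<mu> \<phi> \<phi>h) g / L)"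
      for n and g :: "'a \<Rightarrow> real"
      using L by simp
    from *[unfolded eq] show "\<exists>C>0. \<exists>\<rho>. 0 < \<rho> \<and> \<rho> < 1 \<and> (\<forall>\<^sub>F n in sequentially. \<forall>g\<in>l1 (nu \<mu> \<phi> \<phi>h). \<forall>x.
        \<bar>Q n g x / Q n h x - (\<Sum>\<^sub>\<infinity>y. g y * nu \<mu> \<phi> \<phi>h y) / (\<Sum>\<^sub>\<infinity>y. h y * nu \<mu> \<phi> \<phi>h y)\<bar>
          \<le> C * \<rho> ^ n * (l1_norm (nu \<mu> \<phi> \<phi>h) g / L))"
      using mult_pos_pos[OF C L] \<rho> by blast
  qed
qed

text \<open>Each direction first secures the integrability of \<open>h\<close>: from ergodicity by
  superharmonicity, from (c) by excluding the degenerate measure.\<close>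

lemma ergodic_iff_quasi_ergodic:
  "geom_unif_ergodic (intrinsic (kernel_op k) lam \<phi>) (nu \<mu> \<phi> \<phi>h)
    \<longleftrightarrow> geom_unif_quasi_ergodic (\<lambda>n. kernel_op k ^^ n) (quasi_stat \<mu> \<phi>h)"
proof
  assume "geom_unif_ergodic (intrinsic (kernel_op k) lam \<phi>) (nu \<mu> \<phi> \<phi>h)"
  then have erg: "geom_unif_ergodic Q (nu \<mu> \<phi> \<phi>h)"
    by (simp add: intrinsic_eq)
  have "h \<in> l1 (nu \<mu> \<phi> \<phi>h)"
    by (rule ergodic_imp_superharmonic_l1[OF h_pos erg h_summable h_superharmonic])
  then show "geom_unif_quasi_ergodic (\<lambda>n. kernel_op k ^^ n) (quasi_stat \<mu> \<phi>h)"
    using ergodic_imp_quasi_ergodic[of h, OF h_pos erg] quasi_ergodic_iff by blast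
next
  assume quasi: "geom_unif_quasi_ergodic (\<lambda>n. kernel_op k ^^ n) (quasi_stat \<mu> \<phi>h)"
  have h: "h \<in> l1 (nu \<mu> \<phi> \<phi>h)"
    by (rule quasi_ergodic_imp_h_l1[OF quasi])
  then have "ultrabounded"
    using quasi quasi_ergodic_imp_ultrabounded[of h, OF h_pos _ h] quasi_ergodic_iff by blast
  then show "geom_unif_ergodic (intrinsic (kernel_op k) lam \<phi>) (nu \<mu> \<phi> \<phi>h)"
    using ultrabounded_imp_ergodic by (simp add: intrinsic_eq)
qed

end

section \<open>Application to the Feynman-Kac kernels\<close>

text \<open>The weighted inequality between arithmetic and geometric means, with
  \<open>p \<le> C * w\<close>, gives a summable majorant. It ensures that the eigenvalue equations
  speak of convergent sums and not of the default value 0.\<close>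

lemma l2_pairing_summable:
  fixes f p w :: "'a \<Rightarrow> real"
  assumes p: "p summable_on UNIV" "\<And>y. 0 \<le> p y" "\<And>y. p y \<le> C * w y"
    and w: "\<And>y. 0 < w y" and f: "f \<in> l2 w" "\<And>y. 0 \<le> f y"
  shows "(\<lambda>y. p y * f y) summable_on UNIV"
proof (rule summable_on_comparison_test)
  show "(\<lambda>y. C * p y + (norm (f y))\<^sup>2 * w y) summable_on UNIV"
    using p(1) f(1) unfolding l2_def by (intro summable_on_add summable_on_cmult_right) auto
  fix y
  have "0 \<le> (p y - f y * w y)\<^sup>2"
    by simp
  then have "2 * (p y * f y) * w y \<le> p y * p y + (f y)\<^sup>2 * w y * w y"
    by (simp add: power2_eq_square algebra_simps)
  also have "\<dots> \<le> (C * p y + (f y)\<^sup>2 * w y) * w y"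
    using mult_left_mono[OF p(3)[of y] p(2)[of y]] by (simp add: algebra_simps)
  finally have "2 * (p y * f y) \<le> C * p y + (f y)\<^sup>2 * w y"
    using w[of y] by simp
  moreover show "0 \<le> p y * f y"
    using p f by simp
  ultimately show "p y * f y \<le> C * p y + (norm (f y))\<^sup>2 * w y"
    by simp
qed

theorem theorem6p6:
  fixes P Ph :: "'a \<Rightarrow> 'a \<Rightarrow> real" and \<mu> V \<phi> \<phi>h :: "'a \<Rightarrow> real" and lam Cs :: real
  assumes "countable (UNIV :: 'a set)" and "infinite (UNIV :: 'a set)"
    and "subprob_kernel P" and "subprob_kernel Ph"
    and "\<And>x. 0 < \<mu> x"
    and "\<And>x y. \<mu> x * P x y = \<mu> y * Ph y x"
    and "potential V" and "confining V"
    and "\<And>x y. 0 < P x y"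
    and "1 \<le> Cs" and "\<And>x y. two_step P x y \<le> Cs * P x y"
    and "bdd_above (range (\<lambda>(x, y). P x y / \<mu> y))"
    and "lam = l2_spectral_radius \<mu> (opU P V)"
    and "positive_normalized_eigenfunction \<mu> (opU P V) lam \<phi>"
    and "positive_normalized_eigenfunction \<mu> (opUhat Ph V) lam \<phi>h"
  defines "\<nu> \<equiv> nu \<mu> \<phi> \<phi>h"
  defines "m \<equiv> quasi_stat \<mu> \<phi>h" and "mh \<equiv> quasi_stat \<mu> \<phi>"
  defines "U \<equiv> (\<lambda>n. opU P V ^^ n)" and "Uh \<equiv> (\<lambda>n. opUhat Ph V ^^ n)"
  defines "Q \<equiv> intrinsic (opU P V) lam \<phi>" and "Qh \<equiv> intrinsic (opUhat Ph V) lam \<phi>h"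
  defines "a \<equiv> aIUC (opU P V) lam \<phi> \<nu>" and "ah \<equiv> aIUC (opUhat Ph V) lam \<phi>h \<nu>"
  defines "b \<equiv> geom_unif_ergodic Q \<nu>" and "bh \<equiv> geom_unif_ergodic Qh \<nu>"
  defines "c \<equiv> geom_unif_quasi_ergodic U m" and "ch \<equiv> geom_unif_quasi_ergodic Uh mh"
  shows "(a \<longleftrightarrow> b) \<and> (b \<longleftrightarrow> c) \<and> (ah \<longleftrightarrow> bh) \<and> (bh \<longleftrightarrow> ch) \<and>
    (a \<longleftrightarrow> ah) \<and> (b \<longleftrightarrow> bh) \<and> (c \<longleftrightarrow> ch)"
proof -
  have P: "0 \<le> P x y" "P x summable_on UNIV" "(\<Sum>\<^sub>\<infinity>y. P x y) \<le> 1"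
    and Ph: "0 \<le> Ph x y" "Ph x summable_on UNIV" "(\<Sum>\<^sub>\<infinity>y. Ph x y) \<le> 1" for x y
    using assms(3,4) by (auto simp: subprob_kernel_def)
  have \<mu>: "0 < \<mu> x" and V: "0 < V x" and bal: "\<mu> x * P x y = \<mu> y * Ph y x" for x y
    using assms(5,6,7) by (auto simp: potential_def)
  define v where "v = (INF x. V x)"
  have v: "0 < v" "v \<le> V x" for x
    using assms(7) V
    by (auto simp: potential_def v_def intro!: cINF_lower bdd_belowI2[of _ 0] intro: less_imp_le)
  have inv_le: "1 / V x \<le> 1 / v" for x
    using v V by (simp add: frac_le)
  obtain C where C: "\<And>x y. P x y \<le> C * \<mu> y"
    using assms(12) \<mu> by (force simp: bdd_above_def pos_divide_le_eq)
  \<comment> \<open>Duality hands the density bound on to \<open>Ph\<close> with the same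
    constant.\<close>
  have Ch: "Ph x y \<le> C * \<mu> y" for x y
  proof -
    have "\<mu> x * Ph x y \<le> \<mu> x * (C * \<mu> y)"
      using bal[of y x] mult_left_mono[OF C[of y x], of "\<mu> y"] \<mu>[of y] by (simp add: mult_ac)
    then show ?thesis
      using \<mu>[of x] by (simp add: mult_le_cancel_left_pos)
  qed
  have \<phi>: "0 < \<phi> x" "\<phi> \<in> l2 \<mu>" "opU P V \<phi> x = lam * \<phi> x"
    and \<phi>h: "0 < \<phi>h x" "\<phi>h \<in> l2 \<mu>" "opUhat Ph V \<phi>h x = lam * \<phi>h x" for x
    using assms(14,15) by (auto simp: positive_normalized_eigenfunction_def)
  \<comment> \<open>The potential is evaluated at the source in \<open>k\<close> and at the target
    in \<open>kh\<close>, so the kernels are adjoint with respect to \<mu>.\<close>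
  define k where "k = (\<lambda>x y. P x y * (1 / V x))"
  define kh where "kh = (\<lambda>x y. Ph x y * (1 / V y))"
  have opU: "opU P V = kernel_op k"
  proof (intro ext)
    fix f :: "'a \<Rightarrow> real" and x
    have "(\<Sum>\<^sub>\<infinity>y. (1 / V x) * (P x y * f y)) = (1 / V x) * (\<Sum>\<^sub>\<infinity>y. P x y * f y)"
      by (rule infsum_cmult_right')
    then show "opU P V f x = kernel_op k f x"
      by (simp add: opU_def kernel_op_def k_def)
  qed
  have opUhat: "opUhat Ph V = kernel_op kh"
    by (simp add: opUhat_def kernel_op_def kh_def fun_eq_iff)
  have k_pos: "0 < k x y" for x y
    using assms(9) V by (simp add: k_def)
  have k_sum: "k x summable_on UNIV" for x
    unfolding k_def by (rule summable_on_cmult_left[OF P(2)])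
  have kh_le: "Ph x y * (1 / V y) \<le> Ph x y * (1 / v)" for x y
    by (rule mult_left_mono[OF inv_le Ph(1)])
  have kh_sum: "kh x summable_on UNIV" for x
    unfolding kh_def
    by (rule summable_on_comparison_test[OF summable_on_cmult_left[OF Ph(2)] kh_le])
      (use Ph V in \<open>simp add: less_imp_le\<close>)
  have k\<phi>: "(\<lambda>y. k x y * \<phi> y) summable_on UNIV" for x
    using summable_on_cmult_right[OF l2_pairing_summable[OF P(2,1) C \<mu> \<phi>(2)], of "1 / V x"] \<phi>(1)
    by (simp add: k_def less_imp_le)
  have kh\<phi>h: "(\<lambda>y. kh x y * \<phi>h y) summable_on UNIV" for x
  proof (rule summable_on_comparison_test)
    show "(\<lambda>y. Ph x y * \<phi>h y * (1 / v)) summable_on UNIV"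
      by (rule summable_on_cmult_left[OF l2_pairing_summable[OF Ph(2,1) Ch \<mu> \<phi>h(2)]])
        (use \<phi>h(1) in \<open>simp add: less_imp_le\<close>)
    show "kh x y * \<phi>h y \<le> Ph x y * \<phi>h y * (1 / v)" for y
      using mult_right_mono[OF kh_le[of x y], of "\<phi>h y"] \<phi>h(1)[of y] by (simp add: kh_def)
    show "0 \<le> kh x y * \<phi>h y" for y
      using Ph V \<phi>h(1) by (simp add: kh_def less_imp_le)
  qed
  have eigen: "((\<lambda>y. k x y * \<phi> y) has_sum lam * \<phi> x) UNIV" for x
    using has_sum_infsum[OF k\<phi>[of x]] \<phi>(3)[of x] by (simp add: opU kernel_op_def)
  have lam: "0 < lam"
  proof -
    define x :: 'a where "x = undefined"
    \<comment> \<open>A single positive term of the eigenvalue equation already forces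
      \<open>lam\<close> to be positive.\<close>
    have "k x x * \<phi> x \<le> lam * \<phi> x"
      using finite_sum_le_has_sum[OF eigen[of x], of "{x}"] k_pos \<phi>(1) by (simp add: less_imp_le)
    then show ?thesis
      using k_pos[of x x] \<phi>(1)[of x] by simp
  qed
  have "nu \<mu> \<phi> \<phi>h summable_on UNIV"
  proof (rule summable_on_comparison_test)
    show "(\<lambda>x. (norm (\<phi> x))\<^sup>2 * \<mu> x + (norm (\<phi>h x))\<^sup>2 * \<mu> x) summable_on UNIV"
      using \<phi>(2) \<phi>h(2) unfolding l2_def by (intro summable_on_add) auto
    fix x
    have "\<phi> x * \<phi>h x \<le> (\<phi> x)\<^sup>2 + (\<phi>h x)\<^sup>2"
      using sum_squares_bound[of "\<phi> x" "\<phi>h x"] mult_pos_pos[OF \<phi>(1)[of x] \<phi>h(1)[of x]] by linarith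
    then show "nu \<mu> \<phi> \<phi>h x \<le> (norm (\<phi> x))\<^sup>2 * \<mu> x + (norm (\<phi>h x))\<^sup>2 * \<mu> x"
      using mult_right_mono[of _ _ "\<mu> x"] \<mu>[of x] by (simp add: nu_def distrib_right[symmetric])
    show "0 \<le> nu \<mu> \<phi> \<phi>h x"
      using \<mu> \<phi>(1) \<phi>h(1) by (simp add: nu_def less_imp_le)
  qed
  moreover have "(\<Sum>\<^sub>\<infinity>y. k x y) \<le> 1 / v" for x
  proof -
    have "(\<Sum>\<^sub>\<infinity>y. k x y) = (\<Sum>\<^sub>\<infinity>y. P x y) * (1 / V x)"
      unfolding k_def by (rule infsum_cmult_left')
    also have "\<dots> \<le> 1 * (1 / v)"
      using P(3) inv_le V by (intro mult_mono) (auto simp: less_imp_le)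
    finally show ?thesis by simp
  qed
  moreover have "(\<Sum>\<^sub>\<infinity>y. kh x y) \<le> 1 / v" for x
  proof -
    have "(\<Sum>\<^sub>\<infinity>y. kh x y) \<le> (\<Sum>\<^sub>\<infinity>y. Ph x y * (1 / v))"
      using infsum_mono[OF kh_sum summable_on_cmult_left[OF Ph(2)]] kh_le unfolding kh_def by blast
    also have "\<dots> \<le> 1 * (1 / v)"
      unfolding infsum_cmult_left' using Ph(3) v by (intro mult_right_mono) (auto simp: less_imp_le)
    finally show ?thesis by simp
  qed
  moreover have "((\<lambda>y. kh x y * \<phi>h y) has_sum lam * \<phi>h x) UNIV" for x
    using has_sum_infsum[OF kh\<phi>h[of x]] \<phi>h(3)[of x] by (simp add: opUhat kernel_op_def)
  moreover have "\<mu> x * k x y = \<mu> y * kh y x" for x y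
    using bal[of x y] by (simp add: k_def kh_def)
  ultimately interpret doob_pair k kh \<mu> \<phi> \<phi>h lam "1 / v"
    using k_pos k_sum kh_sum \<mu> \<phi>(1) \<phi>h(1) eigen lam by unfold_locales
  interpret d: doob_pair kh k \<mu> \<phi>h \<phi> lam "1 / v"
    by (rule dual_pair)
  have "a \<longleftrightarrow> b" and "b \<longleftrightarrow> c"
    unfolding a_def b_def c_def Q_def U_def m_def \<nu>_def opU
    by (rule aIUC_iff_ergodic, rule ergodic_iff_quasi_ergodic)
  moreover have "ah \<longleftrightarrow> bh" and "bh \<longleftrightarrow> ch"
    unfolding ah_def bh_def ch_def Qh_def Uh_def mh_def \<nu>_def opUhat nu_commute[symmetric]
    by (rule d.aIUC_iff_ergodic, rule d.ergodic_iff_quasi_ergodic)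
  \<comment> \<open>Duality is needed for (a) only; the other dual equivalences follow through the
    two chains.\<close>
  moreover have "a \<longleftrightarrow> ah"
    unfolding a_def ah_def \<nu>_def opU opUhat
    using aIUC_imp_dual d.aIUC_imp_dual unfolding nu_commute by blast
  ultimately show ?thesis
    by blast
qed

end
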